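(* Let $\mathcal{F} = \{f_i\}_{i \in I}$ be a frame for $H$, and let $a \colon I \to G$ be a map such that $D^+(I,a) < \infty$. Let $S$ be the frame operator of $\mathcal{F}$, let $\tilde{\mathcal{F}} = \{\tilde f_i\}_{i\in I}$, $\tilde f_i = S^{-1} f_i$, be the canonical dual frame, and let $S^{-1/2}(\mathcal{F}) = \{S^{-1/2} f_i\}_{i\in I}$ be the canonical Parseval frame. If $(\mathcal{F},a)$ is $\ell^1$-self-localized, then: (a) $(\mathcal{F},a)$ is $\ell^1$-localized with respect to its canonical dual frame $\tilde{\mathcal{F}}$; (b) $(\tilde{\mathcal{F}},a)$ is $\ell^1$-self-localized; and (c) $(S^{-1/2}(\mathcal{F}),a)$ is $\ell^1$-self-localized.
   Context: $H$ is a separable Hilbert space and $I$ is a countable index set. $G = \prod_{i=1}^d a_i \mathbf{Z} \times \prod_{j=1}^e \mathbf{Z}_{n_j}$ (with $d \ge 1$, $a_i>0$, a countably infinite abelian group), equipped with $|g| = \sup\{|a_1 k_1|,\dots,|a_d k_d|,\delta(m_1),\dots,\delta(m_e)\}$ for $g=(a_1k_1,\dots,a_dk_d,m_1,\dots,m_e)$, where $\delta(0)=0$ and $\delta(m)=1$ for $m\neq 0$. For $N \in \mathbf{N}$ and $j\in G$ put $S_N(j) = \{k \in G : |k-j| \le N/2\}$ and $I_N(j) = a^{-1}(S_N(j))$. The upper density is $D^+(I,a) = \limsup_{N\to\infty} \sup_{j\in G} |I_N(j)|/|S_N(j)|$, where $|\cdot|$ of a set is its cardinality. A frame for $H$ is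 a sequence with constants $A,B>0$ such that $A\|f\|^2 \le \sum_i |\langle f,f_i\rangle|^2 \le B\|f\|^2$ for all $f\in H$; its frame operator is $Sf = \sum_i \langle f,f_i\rangle f_i$. A pair $(\{g_i\}_{i\in I},a)$, with $g_i\in H$, is $\ell^1$-self-localized if there exists $r \in \ell^1(G)$ such that $|\langle g_i,g_j\rangle| \le r_{a(i)-a(j)}$ for all $i,j\in I$. $(\mathcal{F},a)$ is $\ell^1$-localized with respect to its canonical dual frame if there exists $r\in \ell^1(G)$ such that $|\langle f_i,\tilde f_j\rangle| \le r_{a(i)-a(j)}$ for all $i,j\in I$. *)

theory Defs
  imports "HOL-Analysis.Analysis" "HOL-Algebra.Product_Groups"
begin

text \<open>
  A Hilbert space over the scalar field \<open>K\<close>, which is either the reals (seen inside the complex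
  numbers) or the complex numbers. The norm, the topology and completeness come from the underlying
  real inner product space, whose inner product is the real part of \<open>ip\<close>. The inner product
  \<open>ip\<close> is linear in its first argument; \<open>scaleK c\<close> is meaningful for \<open>c \<in> K\<close> only.
\<close>

locale hilbert_space =
  fixes K :: "complex set"
    and scaleK :: "complex \<Rightarrow> 'h::{real_inner, complete_space} \<Rightarrow> 'h"
    and ip :: "'h \<Rightarrow> 'h \<Rightarrow> complex"
  assumes scalar_field: "K = \<real> \<or> K = UNIV"
    and scale_of_real: "scaleK (of_real r) x = r *\<^sub>R x"
    and scale_add_right: "c \<in> K \<Longrightarrow> scaleK c (x + y) = scaleK c x + scaleK c y"
    and scale_add_left: "c \<in> K \<Longrightarrow> c' \<in> K \<Longrightarrow> scaleK (c + c') x = scaleK c x + scaleK c' x"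
    and scale_scale: "c \<in> K \<Longrightarrow> c' \<in> K \<Longrightarrow> scaleK c (scaleK c' x) = scaleK (c * c') x"
    and ip_in_scalars: "ip x y \<in> K"
    and ip_add_left: "ip (x + y) z = ip x z + ip y z"
    and ip_scale_left: "c \<in> K \<Longrightarrow> ip (scaleK c x) y = c * ip x y"
    and ip_commute: "ip y x = cnj (ip x y)"
    and Re_ip: "Re (ip x y) = x \<bullet> y"

lemma hilbert_space_real:
  "hilbert_space \<real> (\<lambda>c (x::'h::{real_inner, complete_space}). Re c *\<^sub>R x)
     (\<lambda>x y. complex_of_real (x \<bullet> y))"
  by unfold_locales
    (auto simp: algebra_simps inner_add_left inner_commute complex_eq_iff complex_is_Real_iff)

lemma hilbert_space_complex: "hilbert_space UNIV (*) (\<lambda>x y. x * cnj y)"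
  by unfold_locales (auto simp: algebra_simps inner_complex_def scaleR_conv_of_real)

definition positive_operator ::
  "complex set \<Rightarrow> (complex \<Rightarrow> 'h::real_inner \<Rightarrow> 'h) \<Rightarrow> ('h \<Rightarrow> 'h \<Rightarrow> complex) \<Rightarrow> ('h \<Rightarrow> 'h) \<Rightarrow> bool"
  where "positive_operator K scaleK ip T \<longleftrightarrow>
    bounded_linear T \<and> (\<forall>c\<in>K. \<forall>x. T (scaleK c x) = scaleK c (T x)) \<and>
    (\<forall>x y. ip (T x) y = ip x (T y)) \<and> (\<forall>x. 0 \<le> Re (ip (T x) x))"

text \<open>\<open>S\<^sup>-\<^sup>1\<^sup>/\<^sup>2\<close>, the positive square root of the inverse of a positive
  invertible operator \<open>S\<close>.\<close>

definition inv_sqrt_operator ::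
  "complex set \<Rightarrow> (complex \<Rightarrow> 'h::real_inner \<Rightarrow> 'h) \<Rightarrow> ('h \<Rightarrow> 'h \<Rightarrow> complex) \<Rightarrow> ('h \<Rightarrow> 'h) \<Rightarrow> 'h \<Rightarrow> 'h"
  where "inv_sqrt_operator K scaleK ip S =
    (THE T. positive_operator K scaleK ip T \<and> (\<forall>x. T (T x) = inv_into UNIV S x))"

definition is_frame ::
  "('h::real_normed_vector \<Rightarrow> 'h \<Rightarrow> complex) \<Rightarrow> 'i set \<Rightarrow> ('i \<Rightarrow> 'h) \<Rightarrow> bool"
  where "is_frame ip I f \<longleftrightarrow>
    (\<exists>A>0. \<exists>B>0. \<forall>x. (\<lambda>i. (cmod (ip x (f i)))\<^sup>2) summable_on I \<and>
       A * (norm x)\<^sup>2 \<le> (\<Sum>\<^sub>\<infinity>i\<in>I. (cmod (ip x (f i)))\<^sup>2) \<and>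
       (\<Sum>\<^sub>\<infinity>i\<in>I. (cmod (ip x (f i)))\<^sup>2) \<le> B * (norm x)\<^sup>2)"

definition frame_operator ::
  "(complex \<Rightarrow> 'h::real_normed_vector \<Rightarrow> 'h) \<Rightarrow> ('h \<Rightarrow> 'h \<Rightarrow> complex) \<Rightarrow> 'i set \<Rightarrow> ('i \<Rightarrow> 'h) \<Rightarrow> 'h \<Rightarrow> 'h"
  where "frame_operator scaleK ip I f x = (\<Sum>\<^sub>\<infinity>i\<in>I. scaleK (ip x (f i)) (f i))"

definition canonical_dual ::
  "(complex \<Rightarrow> 'h::real_normed_vector \<Rightarrow> 'h) \<Rightarrow> ('h \<Rightarrow> 'h \<Rightarrow> complex) \<Rightarrow> 'i set \<Rightarrow> ('i \<Rightarrow> 'h) \<Rightarrow> 'i \<Rightarrow> 'h"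
  where "canonical_dual scaleK ip I f i = inv_into UNIV (frame_operator scaleK ip I f) (f i)"

definition canonical_parseval ::
  "complex set \<Rightarrow> (complex \<Rightarrow> 'h::real_inner \<Rightarrow> 'h) \<Rightarrow> ('h \<Rightarrow> 'h \<Rightarrow> complex) \<Rightarrow> 'i set \<Rightarrow> ('i \<Rightarrow> 'h) \<Rightarrow> 'i \<Rightarrow> 'h"
  where "canonical_parseval K scaleK ip I f i =
    inv_sqrt_operator K scaleK ip (frame_operator scaleK ip I f) (f i)"

type_synonym index = "(nat \<Rightarrow> real) \<times> (nat \<Rightarrow> int)"

definition lattice_group :: "real \<Rightarrow> real monoid"
  where "lattice_group \<alpha> =
    \<lparr>carrier = range (\<lambda>k::int. \<alpha> * of_int k), monoid.mult = (+), one = 0\<rparr>"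

text \<open>The group \<open>\<Prod>\<^sub>i\<^sub><\<^sub>d \<alpha>\<^sub>i\<int> \<times> \<Prod>\<^sub>j\<^sub><\<^sub>e \<int>\<^sub>n\<^sub>j\<close>, written multiplicatively as in
  HOL-Algebra. Elements of \<open>integer_mod_group m\<close> are represented by \<open>0, \<dots>, m - 1\<close>
  if \<open>m > 0\<close>.\<close>

definition index_group ::
  "nat \<Rightarrow> (nat \<Rightarrow> real) \<Rightarrow> nat \<Rightarrow> (nat \<Rightarrow> nat) \<Rightarrow> index monoid"
  where "index_group d \<alpha> e n =
    product_group {..<d} (\<lambda>i. lattice_group (\<alpha> i)) \<times>\<times>
    product_group {..<e} (\<lambda>j. integer_mod_group (n j))"

definition index_diff :: "index monoid \<Rightarrow> index \<Rightarrow> index \<Rightarrow> index"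
  where "index_diff G g h = g \<otimes>\<^bsub>G\<^esub> inv\<^bsub>G\<^esub> h"

definition index_norm :: "nat \<Rightarrow> nat \<Rightarrow> index \<Rightarrow> real"
  where "index_norm d e g =
    Sup ((\<lambda>i. \<bar>fst g i\<bar>) ` {..<d} \<union> (\<lambda>j. if snd g j = 0 then 0 else 1) ` {..<e})"

definition index_box :: "nat \<Rightarrow> (nat \<Rightarrow> real) \<Rightarrow> nat \<Rightarrow> (nat \<Rightarrow> nat) \<Rightarrow> nat \<Rightarrow> index \<Rightarrow> index set"
  where "index_box d \<alpha> e n N j =
    {k \<in> carrier (index_group d \<alpha> e n).
       index_norm d e (index_diff (index_group d \<alpha> e n) k j) \<le> real N / 2}"

text \<open>Cardinalities are taken in \<open>[0, \<infinity>]\<close>, as \<open>a\<close> may have infinite fibres.\<close>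

definition upper_density ::
  "nat \<Rightarrow> (nat \<Rightarrow> real) \<Rightarrow> nat \<Rightarrow> (nat \<Rightarrow> nat) \<Rightarrow> 'i set \<Rightarrow> ('i \<Rightarrow> index) \<Rightarrow> ennreal"
  where "upper_density d \<alpha> e n I a =
    limsup (\<lambda>N. SUP j\<in>carrier (index_group d \<alpha> e n).
      emeasure (count_space UNIV) {i \<in> I. a i \<in> index_box d \<alpha> e n N j} /
      emeasure (count_space UNIV) (index_box d \<alpha> e n N j))"

definition l1_localized ::
  "('h \<Rightarrow> 'h \<Rightarrow> complex) \<Rightarrow> index monoid \<Rightarrow> 'i set \<Rightarrow> ('i \<Rightarrow> index) \<Rightarrow> ('i \<Rightarrow> 'h) \<Rightarrow> ('i \<Rightarrow> 'h) \<Rightarrow> bool"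
  where "l1_localized ip G I a f g \<longleftrightarrow>
    (\<exists>r :: index \<Rightarrow> real. (\<lambda>k. \<bar>r k\<bar>) summable_on carrier G \<and>
       (\<forall>i\<in>I. \<forall>j\<in>I. cmod (ip (f i) (g j)) \<le> r (index_diff G (a i) (a j))))"

definition l1_self_localized ::
  "('h \<Rightarrow> 'h \<Rightarrow> complex) \<Rightarrow> index monoid \<Rightarrow> 'i set \<Rightarrow> ('i \<Rightarrow> index) \<Rightarrow> ('i \<Rightarrow> 'h) \<Rightarrow> bool"
  where "l1_self_localized ip G I a g \<longleftrightarrow> l1_localized ip G I a g g"

end

theory Submission
  imports Defs
begin

text \<open>
  Let \<open>C x = (\<langle>x, f\<^sub>i\<rangle>)\<^sub>i\<close> be the analysis operator, so that \<open>S = C\<^sup>* C\<close> and \<open>C C\<^sup>*\<close> is the Gram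
  matrix. Self-adjointness of \<open>S\<^sup>-\<^sup>1\<close> and \<open>S\<^sup>-\<^sup>1\<^sup>/\<^sup>2\<close> turns the inner products in (a) and (c) into
  \<open>\<langle>f\<^sub>i, S\<^sup>-\<^sup>1 f\<^sub>j\<rangle>\<close> and those in (b) into \<open>\<langle>f\<^sub>i, S\<^sup>-\<^sup>2 f\<^sub>j\<rangle>\<close>. So it is enough to bound
  \<open>\<langle>S\<^sup>-\<^sup>k\<^sup>-\<^sup>1 f\<^sub>j, f\<^sub>i\<rangle>\<close>, for each \<open>k\<close>, by a summable function of \<open>a(i) - a(j)\<close>; this is
  \<open>inverse_powers_localized\<close>.

  The lower frame bound says that \<open>S\<close> cannot shrink the coefficient sequence by more than the
  factor \<open>A\<close>. The proof makes this local. Let \<open>\<phi>\<close> be a tent of radius \<open>L\<close> about a point \<open>j\<close> of the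
  group. The truncated sequence \<open>\<phi> C x\<close> is nearly in the range of \<open>C\<close>, up to commutators of
  \<open>\<phi>\<close> with the Gram matrix, whence \<open>\<parallel>\<phi> C x\<parallel> \<le> \<parallel>\<phi> C S x\<parallel> / A\<close> up to commutators at \<open>x\<close> and at
  \<open>S\<^sup>-\<^sup>1 x\<close> (\<open>truncated_lower_bound\<close>). A commutator has the entries
  \<open>(\<phi>(l) - \<phi>(m)) \<langle>f\<^sub>m, f\<^sub>l\<rangle>\<close>, which are at most \<open>min(1, |k| / L) r(k)\<close> with \<open>k = a(m) - a(l)\<close>. By Schur's
  test its norm is bounded by the convolution of the local norms \<open>j' \<mapsto> \<parallel>\<phi>\<^sub>j\<^sub>' C x\<parallel>\<close> with a
  kernel (\<open>commutator_bound\<close>). The total mass of the kernel tends to \<open>0\<close> as \<open>L\<close> grows: the function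
  \<open>min(1, |k| / L) r(k)\<close> does so by dominated convergence (\<open>damped_small\<close>), and the remaining factor is the
  ratio of the sizes of two concentric balls, which the doubling property of the group keeps bounded
  (\<open>sum_window_kernel_le\<close>). The upper density enters only through the consequence that the fibres of \<open>a\<close> have
  bounded cardinality (\<open>upper_density_finite_fibres\<close>).

  Applied to \<open>x = S\<^sup>-\<^sup>k\<^sup>-\<^sup>1 f\<^sub>i\<close>, for all \<open>k\<close> simultaneously and with geometric weights, this gives for
  \<open>t(g)\<close>, the supremum of the weighted local norms at distance \<open>g\<close> from \<open>a(i)\<close>, an inequality
  \<open>t \<le> y + s * t\<close> in which \<open>y\<close> is summable, \<open>s\<close> has mass at most \<open>1 / 2\<close> and \<open>t\<close> is bounded. Such a \<open>t\<close> is
  summable (\<open>summable_of_convolution_inequality\<close>).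
\<close>

section \<open>Hilbert spaces over the reals or the complex numbers\<close>

context hilbert_space
begin

lemma of_real_in_scalars [simp]: "complex_of_real r \<in> K"
  using scalar_field by auto

lemma cnj_in_scalars: "c \<in> K \<Longrightarrow> cnj c \<in> K"
  using scalar_field by (auto simp: complex_is_Real_iff)

lemma ip_zero_left [simp]: "ip 0 y = 0"
  using ip_add_left[of 0 0 y] by simp

lemma ip_zero_right [simp]: "ip x 0 = 0"
  using ip_commute[of 0 x] by simp

lemma ip_add_right: "ip x (y + z) = ip x y + ip x z"
  using ip_commute[of "y + z" x] ip_commute[of y x] ip_commute[of z x] ip_add_left[of y z x]
  by (metis complex_cnj_add ip_commute)

lemma ip_scaleR_left: "ip (r *\<^sub>R x) y = of_real r * ip x y"
  using ip_scale_left[of "of_real r" x y] by (simp add: scale_of_real)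

lemma ip_scale_right: "c \<in> K \<Longrightarrow> ip x (scaleK c y) = cnj c * ip x y"
  using ip_commute[of x "scaleK c y"] ip_scale_left[of c y x] ip_commute[of x y]
  by (metis complex_cnj_mult ip_commute)

lemma ip_scaleR_right: "ip x (r *\<^sub>R y) = of_real r * ip x y"
  using ip_scale_right[of "of_real r" x y] by (simp add: scale_of_real)

lemma ip_minus_left: "ip (- x) y = - ip x y"
  using ip_scaleR_left[of "-1" x y] by simp

lemma ip_diff_left: "ip (x - y) z = ip x z - ip y z"
  using ip_add_left[of x "- y" z] by (simp add: ip_minus_left)

lemma ip_diff_right: "ip x (y - z) = ip x y - ip x z"
  using ip_diff_left[of y z x] by (metis complex_cnj_diff ip_commute)

lemma ip_sum_left: "ip (\<Sum>i\<in>F. g i) y = (\<Sum>i\<in>F. ip (g i) y)"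
  by (induction F rule: infinite_finite_induct) (auto simp: ip_add_left)

lemma cmod_ip_commute: "cmod (ip y x) = cmod (ip x y)"
  by (metis complex_mod_cnj ip_commute)

lemma ip_self: "ip x x = of_real ((norm x)\<^sup>2)"
proof -
  have "Im (ip x x) = 0"
    using ip_commute[of x x] by (metis complex_cnj_cancel_iff complex_is_Real_iff Reals_cnj_iff)
  then show ?thesis
    by (simp add: complex_eq_iff Re_ip power2_norm_eq_inner)
qed

lemma norm_scale: "c \<in> K \<Longrightarrow> norm (scaleK c x) = cmod c * norm x"
proof -
  assume c: "c \<in> K"
  have "complex_of_real ((norm (scaleK c x))\<^sup>2) = c * cnj c * of_real ((norm x)\<^sup>2)"
    unfolding ip_self[symmetric] using c by (simp add: ip_scale_left ip_scale_right)
  then have "(norm (scaleK c x))\<^sup>2 = (cmod c * norm x)\<^sup>2"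
    by (metis complex_norm_square of_real_eq_iff of_real_mult power_mult_distrib)
  then show ?thesis
    by (simp add: power2_eq_iff_nonneg)
qed

lemma cmod_ip_le: "cmod (ip x y) \<le> norm x * norm y"
proof (cases "ip x y = 0")
  case False
  \<comment> \<open>Rotating \<open>x\<close> by \<open>u\<close> makes the inner product real, so that the real Cauchy-Schwarz
    inequality applies; over the reals \<open>u\<close> is a sign and hence a scalar in either case.\<close>
  define u where "u = cnj (ip x y) / of_real (cmod (ip x y))"
  have u: "u \<in> K" "cmod u = 1"
    using scalar_field cnj_in_scalars[OF ip_in_scalars[of x y]] False
    by (auto simp: u_def norm_divide)
  have "u * ip x y = of_real (cmod (ip x y))"
    using False complex_norm_square[of "ip x y"]
    by (simp add: u_def power2_eq_square divide_simps mult.commute)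
  then have "cmod (ip x y) = scaleK u x \<bullet> y"
    using ip_scale_left[OF u(1), of x y] Re_ip[of "scaleK u x" y] by simp
  also have "\<dots> \<le> norm x * norm y"
    using norm_cauchy_schwarz[of "scaleK u x" y] norm_scale[OF u(1), of x] u(2) by simp
  finally show ?thesis .
qed simp

lemma ip_eqI: "(\<And>z. ip x z = ip y z) \<Longrightarrow> x = y"
  using ip_self[of "x - y"] ip_diff_left[of x y "x - y"] by simp

lemma bounded_linear_ip_left: "bounded_linear (\<lambda>x. ip x y)"
  by (rule bounded_linear_intro[where K = "norm y"])
    (auto simp: ip_add_left ip_scaleR_left cmod_ip_le scaleR_conv_of_real)

lemma bounded_linear_ip_right: "bounded_linear (\<lambda>y. ip x y)"
  by (rule bounded_linear_intro[where K = "norm x"])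
    (auto simp: ip_add_right ip_scaleR_right scaleR_conv_of_real mult.commute intro: order_trans[OF cmod_ip_le])

lemma bounded_linear_scale: "c \<in> K \<Longrightarrow> bounded_linear (scaleK c)"
proof (rule bounded_linear_intro[where K = "cmod c"])
  assume c: "c \<in> K"
  fix r x
  show "scaleK c (r *\<^sub>R x) = r *\<^sub>R scaleK c x"
    using c scale_scale[of c "of_real r" x] scale_scale[of "of_real r" c x]
    by (simp add: scale_of_real mult.commute)
qed (auto simp: scale_add_right norm_scale mult.commute)

lemma scale_diff_right: "c \<in> K \<Longrightarrow> scaleK c (x - y) = scaleK c x - scaleK c y"
  by (rule linear_diff[OF bounded_linear.linear[OF bounded_linear_scale]])

lemma scale_scaleR: "c \<in> K \<Longrightarrow> scaleK c (r *\<^sub>R x) = r *\<^sub>R scaleK c x"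
  by (rule linear_scale[OF bounded_linear.linear[OF bounded_linear_scale]])

section \<open>Inverses and square roots of coercive operators\<close>

abbreviation op_inv :: "('h \<Rightarrow> 'h) \<Rightarrow> 'h \<Rightarrow> 'h" where
  "op_inv \<equiv> inv_into UNIV"

abbreviation positive_op :: "('h \<Rightarrow> 'h) \<Rightarrow> bool" where
  "positive_op \<equiv> positive_operator K scaleK ip"

definition coercive :: "('h \<Rightarrow> 'h) \<Rightarrow> bool" where
  "coercive P \<longleftrightarrow> (\<exists>c>0. \<forall>x. c * (norm x)\<^sup>2 \<le> Re (ip (P x) x))"

text \<open>The Richardson iteration: for a small step the operator \<open>1 - \<kappa> P\<close> is a strict
  contraction, since \<open>\<parallel>x - \<kappa> P x\<parallel>\<^sup>2 = \<parallel>x\<parallel>\<^sup>2 - 2 \<kappa> \<langle>P x, x\<rangle> + \<kappa>\<^sup>2 \<parallel>P x\<parallel>\<^sup>2\<close>. Inverses and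
  square roots below are obtained from this contraction by fixed point iteration.\<close>

lemma coercive_contraction:
  assumes "positive_op P" "coercive P"
  obtains \<kappa> q where "\<kappa> > 0" "0 \<le> q" "q < 1" "\<And>x. norm (x - \<kappa> *\<^sub>R P x) \<le> q * norm x"
proof -
  obtain c where c: "c > 0" "\<And>x. c * (norm x)\<^sup>2 \<le> Re (ip (P x) x)"
    using assms(2) by (auto simp: coercive_def)
  have "bounded_linear P"
    using assms(1) by (simp add: positive_operator_def)
  then obtain b' where b': "\<And>x. norm (P x) \<le> norm x * b'"
    using bounded_linear.bounded by blast
  define b where "b = max b' (max c 1)"
  have b: "norm (P x) \<le> b * norm x" for x
    using b'[of x] mult_left_mono[of b' b "norm x"] by (simp add: b_def mult.commute)
  have bpos: "b > 0" "c \<le> b" by (auto simp: b_def)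
  \<comment> \<open>the minimiser of \<open>1 - 2 \<kappa> c + \<kappa>\<^sup>2 b\<^sup>2\<close>\<close>
  define \<kappa> where "\<kappa> = c / b\<^sup>2"
  have \<kappa>: "\<kappa> > 0" using c bpos by (simp add: \<kappa>_def)
  define q where "q = sqrt (1 - c\<^sup>2 / b\<^sup>2)"
  have cb: "0 < c\<^sup>2 / b\<^sup>2" "c\<^sup>2 / b\<^sup>2 \<le> 1"
    using c bpos by (auto simp: divide_le_eq power_mono)
  have "norm (x - \<kappa> *\<^sub>R P x) \<le> q * norm x" for x
  proof -
    have "(norm (x - \<kappa> *\<^sub>R P x))\<^sup>2 = (norm x)\<^sup>2 - 2 * \<kappa> * Re (ip (P x) x) + \<kappa>\<^sup>2 * (norm (P x))\<^sup>2"
      unfolding power2_norm_eq_inner Re_ip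
      by (simp add: inner_diff_left inner_diff_right inner_commute power2_eq_square algebra_simps)
    also have "\<dots> \<le> (norm x)\<^sup>2 - 2 * \<kappa> * (c * (norm x)\<^sup>2) + \<kappa>\<^sup>2 * (b * norm x)\<^sup>2"
      using c(2)[of x] b[of x] \<kappa> by (intro add_mono diff_mono mult_left_mono power_mono) auto
    also have "\<dots> = (1 - c\<^sup>2 / b\<^sup>2) * (norm x)\<^sup>2"
      using bpos by (simp add: \<kappa>_def field_simps power2_eq_square)
    also have "\<dots> = (q * norm x)\<^sup>2"
      using cb by (simp add: q_def power_mult_distrib)
    finally show ?thesis
      by (rule power2_le_imp_le) (use cb in \<open>auto simp: q_def\<close>)
  qed
  moreover have "0 \<le> q" "q < 1"
    using cb by (auto simp: q_def)
  ultimately show ?thesis using that \<kappa> by blast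
qed

lemma coercive_bij:
  assumes "positive_op P" "coercive P"
  shows "bij P"
proof -
  obtain \<kappa> q where kq: "\<kappa> > 0" "0 \<le> q" "q < 1" "\<And>x. norm (x - \<kappa> *\<^sub>R P x) \<le> q * norm x"
    using coercive_contraction[OF assms] by blast
  have lin: "linear P"
    using assms(1) by (simp add: positive_operator_def bounded_linear.linear)
  have "\<exists>!x. P x = y" for y
  proof -
    have "dist (u - \<kappa> *\<^sub>R P u + \<kappa> *\<^sub>R y) (v - \<kappa> *\<^sub>R P v + \<kappa> *\<^sub>R y) \<le> q * dist u v" for u v
    proof -
      have "dist (u - \<kappa> *\<^sub>R P u + \<kappa> *\<^sub>R y) (v - \<kappa> *\<^sub>R P v + \<kappa> *\<^sub>R y)
          = norm ((u - v) - \<kappa> *\<^sub>R P (u - v))"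
        by (simp add: dist_norm linear_diff[OF lin] algebra_simps)
      also have "\<dots> \<le> q * dist u v"
        using kq(4) by (simp add: dist_norm)
      finally show ?thesis .
    qed
    then have "\<exists>!x. x - \<kappa> *\<^sub>R P x + \<kappa> *\<^sub>R y = x"
      by (intro banach_fix_type[OF kq(2,3)]) blast
    moreover have "x - \<kappa> *\<^sub>R P x + \<kappa> *\<^sub>R y = x \<longleftrightarrow> P x = y" for x
      using kq(1) by (auto simp: algebra_simps)
    ultimately show ?thesis by simp
  qed
  then show ?thesis
    by (metis bijI' )
qed

lemma positive_op_inv:
  assumes P: "positive_op P" "coercive P"
  shows "positive_op (op_inv P)" "coercive (op_inv P)"
proof -
  obtain c where c: "c > 0" "\<And>x. c * (norm x)\<^sup>2 \<le> Re (ip (P x) x)"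
    using P(2) by (auto simp: coercive_def)
  have bij: "bij P" by (rule coercive_bij[OF P])
  have PQ [simp]: "P (op_inv P x) = x" for x
    using bij by (simp add: bij_is_surj surj_f_inv_f)
  have QP: "op_inv P x = y \<longleftrightarrow> x = P y" for x y
    using bij by (metis PQ bij_inv_eq_iff)
  have blP: "bounded_linear P" and sP: "\<And>c x. c \<in> K \<Longrightarrow> P (scaleK c x) = scaleK c (P x)"
    and saP: "\<And>x y. ip (P x) y = ip x (P y)"
    using P(1) by (auto simp: positive_operator_def)
  have lin: "linear P" using blP by (rule bounded_linear.linear)
  obtain b where b: "b > 0" "\<And>x. norm (P x) \<le> norm x * b"
    using bounded_linear.pos_bounded[OF blP] by blast
  have low: "c * norm x \<le> norm (P x)" for x
  proof (cases "x = 0")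
    case False
    have "c * (norm x)\<^sup>2 \<le> norm (P x) * norm x"
      using c(2)[of x] norm_cauchy_schwarz[of "P x" x] by (simp add: Re_ip)
    then show ?thesis
      using False by (simp add: power2_eq_square)
  qed simp
  have bl: "bounded_linear (op_inv P)"
  proof (rule bounded_linear_intro[where K = "1 / c"])
    show "op_inv P (x + y) = op_inv P x + op_inv P y" for x y
      by (simp add: QP linear_add[OF lin])
    show "op_inv P (r *\<^sub>R x) = r *\<^sub>R op_inv P x" for r x
      by (simp add: QP linear_scale[OF lin])
    show "norm (op_inv P x) \<le> norm x * (1 / c)" for x
      using low[of "op_inv P x"] c(1) by (simp add: field_simps)
  qed
  have pos: "c / b\<^sup>2 * (norm x)\<^sup>2 \<le> Re (ip (op_inv P x) x)" for x
  proof -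
    have "(norm x)\<^sup>2 \<le> (norm (op_inv P x))\<^sup>2 * b\<^sup>2"
      using power_mono[OF b(2)[of "op_inv P x"], of 2] by (simp add: power_mult_distrib)
    then have "c / b\<^sup>2 * (norm x)\<^sup>2 \<le> c * (norm (op_inv P x))\<^sup>2"
      using b(1) c(1) by (simp add: field_simps)
    also have "\<dots> \<le> Re (ip (op_inv P x) x)"
      using c(2)[of "op_inv P x"] by (simp add: Re_ip inner_commute)
    finally show ?thesis .
  qed
  have "0 \<le> Re (ip (op_inv P x) x)" for x
    by (rule order_trans[OF _ pos[of x]]) (use c(1) in simp)
  moreover have "op_inv P (scaleK c x) = scaleK c (op_inv P x)" if "c \<in> K" for c x
    using that by (simp add: QP sP)
  moreover have "ip (op_inv P x) y = ip x (op_inv P y)" for x y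
    using saP[of "op_inv P x" "op_inv P y"] by simp
  ultimately show "positive_op (op_inv P)"
    using bl by (simp add: positive_operator_def)
  show "coercive (op_inv P)"
    unfolding coercive_def using pos b c(1) by (intro exI[of _ "c / b\<^sup>2"]) auto
qed

text \<open>Pointwise limits of the iterates below are again of this form, so the limit is
  automatically bounded, self-adjoint and linear over the scalars.\<close>

definition contractive :: "real \<Rightarrow> ('h \<Rightarrow> 'h) \<Rightarrow> bool" where
  "contractive q T \<longleftrightarrow> linear T \<and> (\<forall>x. norm (T x) \<le> q * norm x) \<and>
     (\<forall>c\<in>K. \<forall>x. T (scaleK c x) = scaleK c (T x)) \<and> (\<forall>x y. ip (T x) y = ip x (T y))"

text \<open>The iteration \<open>T \<mapsto> (W + T\<^sup>2) / 2\<close> with start \<open>0\<close>; its fixed points satisfy \<open>(1 - T)\<^sup>2 = 1 - W\<close>.\<close>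

primrec sqrt_iterate :: "('h \<Rightarrow> 'h) \<Rightarrow> nat \<Rightarrow> 'h \<Rightarrow> 'h" where
  "sqrt_iterate W 0 x = 0"
| "sqrt_iterate W (Suc m) x = (1 / 2) *\<^sub>R (W x + sqrt_iterate W m (sqrt_iterate W m x))"

lemma sqrt_iterate_commute:
  assumes "linear Z" "\<And>x. Z (W x) = W (Z x)"
  shows "Z (sqrt_iterate W m x) = sqrt_iterate W m (Z x)"
  by (induction m arbitrary: x)
    (simp_all add: assms linear_0[OF assms(1)] linear_add[OF assms(1)] linear_scale[OF assms(1)])

lemma sqrt_iterate_contractive:
  assumes W: "contractive q W" and q: "0 \<le> q" "q < 1"
  shows "contractive q (sqrt_iterate W m)"
proof (induction m)
  case 0
  have "linear (\<lambda>x. 0 :: 'h)" by (rule linearI) auto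
  then show ?case
    using q(1) bounded_linear_scale by (auto simp: contractive_def linear_0 bounded_linear.linear)
next
  case (Suc m)
  have W': "linear W" "\<And>x. norm (W x) \<le> q * norm x" "\<And>c x. c \<in> K \<Longrightarrow> W (scaleK c x) = scaleK c (W x)"
    "\<And>x y. ip (W x) y = ip x (W y)"
    using W by (auto simp: contractive_def)
  define T where "T = sqrt_iterate W m"
  have T: "linear T" "\<And>x. norm (T x) \<le> q * norm x" "\<And>c x. c \<in> K \<Longrightarrow> T (scaleK c x) = scaleK c (T x)"
    "\<And>x y. ip (T x) y = ip x (T y)"
    using Suc by (auto simp: contractive_def T_def)
  have eq: "sqrt_iterate W (Suc m) = (\<lambda>x. (1 / 2) *\<^sub>R (W x + T (T x)))"
    by (simp add: fun_eq_iff T_def)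
  have "linear (\<lambda>x. (1 / 2) *\<^sub>R (W x + T (T x)))"
    by (rule linearI) (simp_all add: linear_add[OF T(1)] linear_add[OF W'(1)] linear_scale[OF T(1)]
        linear_scale[OF W'(1)] algebra_simps)
  moreover have "norm ((1 / 2) *\<^sub>R (W x + T (T x))) \<le> q * norm x" for x
  proof -
    have "norm (T (T x)) \<le> q * (q * norm x)"
      using T(2)[of "T x"] mult_left_mono[OF T(2)[of x] q(1)] by linarith
    also have "\<dots> \<le> q * (1 * norm x)"
      using q by (intro mult_left_mono mult_right_mono) auto
    finally have "norm (W x + T (T x)) \<le> 2 * (q * norm x)"
      using norm_triangle_ineq[of "W x" "T (T x)"] W'(2)[of x] by simp
    then show ?thesis by simp
  qed
  ultimately show ?case
    unfolding eq contractive_def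
    using W'(3,4) T(3,4)
    by (auto simp: scale_scaleR scale_add_right ip_add_left ip_add_right ip_scaleR_left ip_scaleR_right)
qed

text \<open>Consecutive iterates commute, so the difference of their squares factors as
  \<open>(U + T) (U - T)\<close>, and the sum has norm at most \<open>2 q\<close>.\<close>

lemma sqrt_iterate_step:
  assumes W: "contractive q W" and q: "0 \<le> q" "q < 1"
  shows "norm (sqrt_iterate W (Suc m) x - sqrt_iterate W m x) \<le> q ^ m * (q * norm x)"
proof (induction m arbitrary: x)
  case 0
  have "norm (W x) \<le> q * norm x" using W by (simp add: contractive_def)
  moreover have "0 \<le> q * norm x" using q by simp
  ultimately have "norm (W x) / 2 \<le> q * norm x"
    by linarith
  moreover have "linear W" using W by (simp add: contractive_def)
  ultimately show ?case by simp
next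
  case (Suc m)
  define T where "T = sqrt_iterate W m"
  define U where "U = sqrt_iterate W (Suc m)"
  have lin: "linear T" "linear U" "linear W" and bd: "\<And>x. norm (T x) \<le> q * norm x" "\<And>x. norm (U x) \<le> q * norm x"
    using sqrt_iterate_contractive[OF assms, of m] sqrt_iterate_contractive[OF assms, of "Suc m"] W
    unfolding T_def U_def contractive_def by blast+
  have TW: "T (W x) = W (T x)" for x
    unfolding T_def by (rule sqrt_iterate_commute[symmetric]) (simp_all add: lin)
  have TU: "T (U x) = U (T x)" for x
    unfolding U_def by (rule sqrt_iterate_commute) (simp_all add: lin TW)
  have "sqrt_iterate W (Suc (Suc m)) x - U x = (1/2) *\<^sub>R (U (U x - T x) + T (U x - T x))"
  proof -
    have "sqrt_iterate W (Suc (Suc m)) x = (1/2) *\<^sub>R (W x + U (U x))"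
      unfolding sqrt_iterate.simps(2)[of W "Suc m"] U_def ..
    moreover have "U x = (1/2) *\<^sub>R (W x + T (T x))"
      unfolding U_def T_def by (rule sqrt_iterate.simps(2))
    ultimately have "sqrt_iterate W (Suc (Suc m)) x - U x = (1/2) *\<^sub>R (U (U x) - T (T x))"
      by (metis add_diff_cancel_left scaleR_right_diff_distrib)
    then show ?thesis by (simp add: linear_diff lin TU)
  qed
  also have "norm \<dots> \<le> q * norm (U x - T x)"
    using norm_triangle_ineq[of "U (U x - T x)" "T (U x - T x)"] bd(1)[of "U x - T x"] bd(2)[of "U x - T x"]
    by simp
  also have "\<dots> \<le> q * (q ^ m * (q * norm x))"
    using Suc[of x] q by (intro mult_left_mono) (auto simp: T_def U_def)
  finally show ?case by (simp add: U_def mult.assoc)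
qed

lemma sqrt_iterate_limit:
  assumes W: "contractive q W" and q: "0 \<le> q" "q < 1"
  obtains T where "contractive q T" "\<And>x. (\<lambda>m. sqrt_iterate W m x) \<longlonglongrightarrow> T x"
    "\<And>x. 2 *\<^sub>R T x = W x + T (T x)"
proof -
  let ?s = "sqrt_iterate W"
  have "convergent (\<lambda>m. ?s m x)" for x
  proof -
    have "Cauchy (\<lambda>m. ?s m x)"
    proof -
      have cauchy_test: "Cauchy X" if X: "\<And>m. norm (X (Suc m) - X m) \<le> b m" and b: "summable b"
        for X :: "nat \<Rightarrow> 'h" and b :: "nat \<Rightarrow> real"
      proof (rule CauchyI')
        fix e :: real assume e: "e > 0"
        obtain N where N: "\<And>m n. m \<ge> N \<Longrightarrow> norm (sum b {m..<n}) < e"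
          using b e unfolding summable_Cauchy by blast
        have "dist (X m) (X n) < e" if mn: "m \<ge> N" "m < n" for m n
        proof -
          have "norm (X n - X m) = norm (\<Sum>k=m..<n. X (Suc k) - X k)"
            using mn by (simp add: sum_Suc_diff')
          also have "\<dots> \<le> (\<Sum>k=m..<n. b k)"
            by (rule sum_norm_le) (rule X)
          also have "\<dots> < e" using N[OF mn(1), of n] by simp
          finally show ?thesis by (simp add: dist_norm norm_minus_commute)
        qed
        then show "\<exists>M. \<forall>m\<ge>M. \<forall>n>m. dist (X m) (X n) < e" by blast
      qed
      show ?thesis
        by (rule cauchy_test[where b = "\<lambda>m. q ^ m * (q * norm x)"], rule sqrt_iterate_step[OF assms])
          (use q in \<open>intro summable_mult2 summable_geometric; simp\<close>)
    qed
    then show ?thesis by (simp add: Cauchy_convergent_iff)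
  qed
  then have lim: "(\<lambda>m. ?s m x) \<longlonglongrightarrow> lim (\<lambda>m. ?s m x)" for x
    by (simp only: convergent_LIMSEQ_iff)
  define T where "T x = lim (\<lambda>m. ?s m x)" for x
  have T: "(\<lambda>m. ?s m x) \<longlonglongrightarrow> T x" for x
    unfolding T_def by (rule lim)
  have c: "linear (?s m)" "norm (?s m x) \<le> q * norm x"
    "c \<in> K \<Longrightarrow> ?s m (scaleK c x) = scaleK c (?s m x)" "ip (?s m x) y = ip x (?s m y)" for m c x y
    using sqrt_iterate_contractive[OF assms, of m] unfolding contractive_def by blast+
  have "linear T"
  proof (rule linearI)
    show "T (x + y) = T x + T y" for x y
    proof (rule LIMSEQ_unique[OF T])
      show "(\<lambda>m. ?s m (x + y)) \<longlonglongrightarrow> T x + T y"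
        unfolding linear_add[OF c(1)] by (rule tendsto_add[OF T T])
    qed
    show "T (r *\<^sub>R x) = r *\<^sub>R T x" for r x
    proof (rule LIMSEQ_unique[OF T])
      show "(\<lambda>m. ?s m (r *\<^sub>R x)) \<longlonglongrightarrow> r *\<^sub>R T x"
        unfolding linear_scale[OF c(1)] by (rule tendsto_scaleR[OF tendsto_const T])
    qed
  qed
  moreover have bdT: "norm (T x) \<le> q * norm x" for x
    by (rule tendsto_upperbound[OF tendsto_norm[OF T[of x]]]) (rule always_eventually, rule allI, rule c(2), simp)
  moreover have "T (scaleK k x) = scaleK k (T x)" if "k \<in> K" for k x
  proof (rule LIMSEQ_unique[OF T])
    show "(\<lambda>m. ?s m (scaleK k x)) \<longlonglongrightarrow> scaleK k (T x)"
      unfolding c(3)[OF that] by (rule bounded_linear.tendsto[OF bounded_linear_scale[OF that] T])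
  qed
  moreover have "ip (T x) y = ip x (T y)" for x y
  proof -
    have "(\<lambda>m. ip (?s m x) y) \<longlonglongrightarrow> ip (T x) y"
      by (rule bounded_linear.tendsto[OF bounded_linear_ip_left T])
    moreover have "(\<lambda>m. ip x (?s m y)) \<longlonglongrightarrow> ip x (T y)"
      by (rule bounded_linear.tendsto[OF bounded_linear_ip_right T])
    ultimately show ?thesis unfolding c(4) by (rule LIMSEQ_unique)
  qed
  ultimately have cT: "contractive q T" by (simp add: contractive_def)
  have "2 *\<^sub>R T x = W x + T (T x)" for x
  proof -
    have "(\<lambda>m. ?s m (?s m x - T x)) \<longlonglongrightarrow> 0"
    proof (rule Lim_null_comparison)
      show "\<forall>\<^sub>F m in sequentially. norm (?s m (?s m x - T x)) \<le> q * norm (?s m x - T x)"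
        by (simp add: c(2))
      show "(\<lambda>m. q * norm (?s m x - T x)) \<longlonglongrightarrow> 0"
        using tendsto_mult_right_zero[OF tendsto_norm_zero[OF LIM_zero[OF T[of x]]]] by simp
    qed
    from tendsto_add[OF this T[of "T x"]] have "(\<lambda>m. ?s m (?s m x)) \<longlonglongrightarrow> T (T x)"
      unfolding linear_diff[OF c(1)] by simp
    then have "(\<lambda>m. ?s (Suc m) x) \<longlonglongrightarrow> (1 / 2) *\<^sub>R (W x + T (T x))"
      unfolding sqrt_iterate.simps(2) by (intro tendsto_intros)
    then have "T x = (1 / 2) *\<^sub>R (W x + T (T x))"
      by (rule LIMSEQ_unique[OF LIMSEQ_Suc[OF T[of x]]])
    then have "2 *\<^sub>R T x = 2 *\<^sub>R ((1 / 2) *\<^sub>R (W x + T (T x)))"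
      by (rule arg_cong)
    then show ?thesis by simp
  qed
  then show ?thesis using that cT T by blast
qed

text \<open>If \<open>W = 1 - \<kappa> P\<close> then a fixed point \<open>T = (W + T\<^sup>2) / 2\<close> satisfies
  \<open>(1 - T)\<^sup>2 = \<kappa> P\<close>. Every iterate is a polynomial in \<open>P\<close>, so \<open>T\<close> commutes with every other
  root \<open>R\<close> of \<open>P\<close>; for the root \<open>Y\<close> made from \<open>T\<close> the product \<open>(Y + R) (Y - R)\<close> vanishes,
  and strict positivity of \<open>Y\<close> gives \<open>Y = R\<close>.\<close>

lemma coercive_square_root:
  assumes P: "positive_op P" "coercive P"
  shows "\<exists>!R. positive_op R \<and> (\<forall>x. R (R x) = P x)"
proof -
  obtain \<kappa> q where kq: "\<kappa> > 0" "0 \<le> q" "q < 1" "\<And>x. norm (x - \<kappa> *\<^sub>R P x) \<le> q * norm x"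
    using coercive_contraction[OF assms] by blast
  have linP: "linear P" and sP: "\<And>c x. c \<in> K \<Longrightarrow> P (scaleK c x) = scaleK c (P x)"
    and saP: "\<And>x y. ip (P x) y = ip x (P y)"
    using P(1) by (auto simp: positive_operator_def bounded_linear.linear)
  define W where "W x = x - \<kappa> *\<^sub>R P x" for x
  have "linear W"
    unfolding W_def by (rule linearI) (auto simp: linear_add[OF linP] linear_scale[OF linP] algebra_simps)
  then have W: "contractive q W"
    using kq(4) by (auto simp: contractive_def W_def sP saP scale_diff_right scale_scaleR
        ip_diff_left ip_diff_right ip_scaleR_left ip_scaleR_right)
  obtain T where T: "contractive q T" "\<And>x. (\<lambda>m. sqrt_iterate W m x) \<longlonglongrightarrow> T x"
      "\<And>x. 2 *\<^sub>R T x = W x + T (T x)"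
    using sqrt_iterate_limit[OF W kq(2,3)] by blast
  have T': "linear T" "\<And>x. norm (T x) \<le> q * norm x" "\<And>c x. c \<in> K \<Longrightarrow> T (scaleK c x) = scaleK c (T x)"
    "\<And>x y. ip (T x) y = ip x (T y)"
    using T(1) by (auto simp: contractive_def)
  define b where "b = 1 / sqrt \<kappa>"
  have b: "b > 0" "b * b * \<kappa> = 1" using kq(1) by (auto simp: b_def)
  define Y where "Y x = b *\<^sub>R (x - T x)" for x
  have linY: "linear Y"
    unfolding Y_def by (rule linearI) (auto simp: linear_add[OF T'(1)] linear_scale[OF T'(1)] algebra_simps)
  have YY: "Y (Y x) = P x" for x
  proof -
    have "Y (Y x) = (b * b) *\<^sub>R (x - 2 *\<^sub>R T x + T (T x))"
      by (simp add: Y_def linear_diff[OF T'(1)] linear_scale[OF T'(1)] algebra_simps scaleR_2)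
    also have "x - 2 *\<^sub>R T x + T (T x) = \<kappa> *\<^sub>R P x"
      by (simp add: T(3) W_def)
    finally show ?thesis using b by simp
  qed
  have posY: "b * (1 - q) * (norm x)\<^sup>2 \<le> Re (ip (Y x) x)" for x
  proof -
    have "T x \<bullet> x \<le> q * norm x * norm x"
      using norm_cauchy_schwarz[of "T x" x] mult_right_mono[OF T'(2)[of x], of "norm x"] by simp
    then have "(1 - q) * (norm x)\<^sup>2 \<le> (x - T x) \<bullet> x"
      by (simp add: inner_diff_left power2_norm_eq_inner[symmetric] power2_eq_square algebra_simps)
    then show ?thesis
      using b(1) by (simp add: Y_def Re_ip mult.assoc)
  qed
  have "bounded_linear Y"
  proof (rule bounded_linear_intro[where K = "b * (1 + q)"])
    fix x
    have "norm (x - T x) \<le> (1 + q) * norm x"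
      using norm_triangle_ineq4[of x "T x"] T'(2)[of x] by (simp add: algebra_simps)
    then show "norm (Y x) \<le> norm x * (b * (1 + q))"
      using b(1) mult_left_mono[of _ _ b] by (simp add: Y_def mult_ac)
  qed (auto simp: linear_add[OF linY] linear_scale[OF linY])
  moreover have "0 \<le> Re (ip (Y x) x)" for x
    by (rule order_trans[OF _ posY[of x]]) (use b(1) kq(3) in simp)
  ultimately have Y: "positive_op Y"
    using T'(3,4) by (auto simp: positive_operator_def Y_def scale_diff_right scale_scaleR
        ip_diff_left ip_diff_right ip_scaleR_left ip_scaleR_right)
  have uniq: "R = Y" if R: "positive_op R" "\<And>x. R (R x) = P x" for R
  proof
    fix x
    have blR: "bounded_linear R" and linR: "linear R" using R(1) by (auto simp: positive_operator_def bounded_linear.linear)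
    have "R (P z) = P (R z)" for z
      by (simp only: R(2)[symmetric])
    then have RW: "R (W z) = W (R z)" for z
      by (simp add: W_def linear_diff[OF linR] linear_scale[OF linR])
    have RT: "R (T z) = T (R z)" for z
    proof -
      have "(\<lambda>m. R (sqrt_iterate W m z)) \<longlonglongrightarrow> R (T z)"
        by (rule bounded_linear.tendsto[OF blR T(2)])
      moreover have "(\<lambda>m. R (sqrt_iterate W m z)) = (\<lambda>m. sqrt_iterate W m (R z))"
        by (rule ext) (rule sqrt_iterate_commute[where Z = R and W = W, OF linR], rule RW)
      ultimately show ?thesis using T(2)[of "R z"] LIMSEQ_unique by auto
    qed
    have RY: "R (Y z) = Y (R z)" for z
      by (simp add: Y_def linear_diff[OF linR] linear_scale[OF linR] RT)
    define y where "y = Y x - R x"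
    have "Y y + R y = 0"
      by (simp add: y_def linear_diff[OF linY] linear_diff[OF linR] YY R(2) RY)
    then have "Re (ip (Y y) y) + Re (ip (R y) y) = 0"
      by (metis ip_add_left ip_zero_left plus_complex.simps(1) zero_complex.simps(1))
    moreover have "0 \<le> Re (ip (R y) y)" using R(1) unfolding positive_operator_def by blast
    ultimately have "b * (1 - q) * (norm y)\<^sup>2 \<le> 0" using posY[of y] by linarith
    moreover have "0 < b * (1 - q)" using b(1) kq(3) by simp
    ultimately have "(norm y)\<^sup>2 \<le> 0" by (smt (verit) mult_pos_pos)
    then have "y = 0" by simp
    then show "R x = Y x" by (simp add: y_def)
  qed
  show ?thesis
  proof (rule ex1I[of _ Y])
    show "positive_op Y \<and> (\<forall>x. Y (Y x) = P x)" using Y YY by simp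
    show "R = Y" if "positive_op R \<and> (\<forall>x. R (R x) = P x)" for R
      by (rule uniq) (use that in simp_all)
  qed
qed

end

section \<open>Square-summable sequences\<close>

lemma summable_on_CauchyI:
  fixes g :: "'i \<Rightarrow> 'b::{real_normed_vector, complete_space}"
  assumes "\<And>e. e > 0 \<Longrightarrow> \<exists>F\<^sub>0. finite F\<^sub>0 \<and> F\<^sub>0 \<subseteq> I \<and>
    (\<forall>F. finite F \<longrightarrow> F \<subseteq> I - F\<^sub>0 \<longrightarrow> norm (sum g F) \<le> e)"
  shows "g summable_on I"
proof -
  have "\<exists>P. eventually P (finite_subsets_at_top I) \<and>
      (\<forall>F F'. P F \<and> P F' \<longrightarrow> dist (sum g F) (sum g F') < e)" if e: "e > 0" for e
  proof -
    obtain F\<^sub>0 where F\<^sub>0: "finite F\<^sub>0" "F\<^sub>0 \<subseteq> I"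
      "\<And>F. finite F \<Longrightarrow> F \<subseteq> I - F\<^sub>0 \<Longrightarrow> norm (sum g F) \<le> e / 3"
      using assms[of "e / 3"] e by auto
    define P where "P F \<longleftrightarrow> finite F \<and> F\<^sub>0 \<subseteq> F \<and> F \<subseteq> I" for F
    have "dist (sum g F) (sum g F') < e" if F: "P F" "P F'" for F F'
    proof -
      have tail: "norm (sum g F - sum g F\<^sub>0) \<le> e / 3" if "P F" for F
        using that F\<^sub>0(3)[of "F - F\<^sub>0"] by (auto simp: P_def sum_diff F\<^sub>0(1))
      show ?thesis
        using norm_triangle_ineq4[of "sum g F - sum g F\<^sub>0" "sum g F' - sum g F\<^sub>0"] tail[OF F(1)] tail[OF F(2)] e
        by (simp add: dist_norm)
    qed
    moreover have "eventually P (finite_subsets_at_top I)"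
      unfolding eventually_finite_subsets_at_top P_def using F\<^sub>0(1,2) by blast
    ultimately show ?thesis by blast
  qed
  then have "cauchy_filter (filtermap (sum g) (finite_subsets_at_top I))"
    by (simp add: cauchy_filter_metric_filtermap)
  moreover have "complete (UNIV::'b set)" by blast
  ultimately obtain L where "(sum g \<longlongrightarrow> L) (finite_subsets_at_top I)"
    using complete_uniform[where S = "UNIV :: 'b set"] by (force simp: filterlim_def)
  then show ?thesis
    using summable_on_def has_sum_def by blast
qed

lemma le_if_square_le_mult: "a \<le> c" if "a * a \<le> c * a" "0 \<le> c" for a c :: real
  using that by (meson linorder_not_le mult_right_le_imp_le order_le_less_trans)

lemma L2_set_mono_neutral:
  assumes "finite J" "finite F" "\<And>i. i \<in> F - J \<Longrightarrow> g i = 0"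
  shows "L2_set g F \<le> L2_set g J"
proof -
  have "(\<Sum>i\<in>F. (g i)\<^sup>2) \<le> (\<Sum>i\<in>F \<union> J. (g i)\<^sup>2)"
    using assms by (intro sum_mono2) auto
  also have "\<dots> = (\<Sum>i\<in>J. (g i)\<^sup>2)"
    using assms by (intro sum.mono_neutral_right) auto
  finally show ?thesis by (simp add: L2_set_def)
qed

lemma cmod_has_sum_le_L2:
  assumes sm: "((\<lambda>i. u i * v i) has_sum s) I"
    and U: "\<And>F. finite F \<Longrightarrow> F \<subseteq> I \<Longrightarrow> L2_set (\<lambda>i. cmod (u i)) F \<le> U"
    and V: "\<And>F. finite F \<Longrightarrow> F \<subseteq> I \<Longrightarrow> L2_set (\<lambda>i. cmod (v i)) F \<le> V"
  shows "cmod s \<le> U * V"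
proof -
  have U0: "0 \<le> U" using U[of "{}"] by simp
  have "norm (\<Sum>i\<in>F. u i * v i) \<le> U * V" if F: "finite F" "F \<subseteq> I" for F
  proof -
    have "norm (\<Sum>i\<in>F. u i * v i) \<le> (\<Sum>i\<in>F. \<bar>cmod (u i)\<bar> * \<bar>cmod (v i)\<bar>)"
      by (rule sum_norm_le) (simp add: norm_mult)
    also have "\<dots> \<le> L2_set (\<lambda>i. cmod (u i)) F * L2_set (\<lambda>i. cmod (v i)) F"
      by (rule L2_set_mult_ineq)
    also have "\<dots> \<le> U * V"
      by (intro mult_mono U V F U0) simp
    finally show ?thesis .
  qed
  then show ?thesis
    by (intro tendsto_upperbound[OF tendsto_norm[OF sm[unfolded has_sum_def]]]
        eventually_finite_subsets_at_top_weakI) simp_all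
qed

section \<open>The frame operator\<close>

locale frame = hilbert_space K scaleK ip
  for K and scaleK :: "complex \<Rightarrow> 'h::{real_inner, complete_space} \<Rightarrow> 'h" and ip :: "'h \<Rightarrow> 'h \<Rightarrow> complex" +
  fixes I :: "'i set" and f :: "'i \<Rightarrow> 'h" and A B :: real
  assumes A_pos: "0 < A" and B_pos: "0 < B"
    and square_summable: "(\<lambda>i. (cmod (ip x (f i)))\<^sup>2) summable_on I"
    and lower_bound: "A * (norm x)\<^sup>2 \<le> (\<Sum>\<^sub>\<infinity>i\<in>I. (cmod (ip x (f i)))\<^sup>2)"
    and upper_bound: "(\<Sum>\<^sub>\<infinity>i\<in>I. (cmod (ip x (f i)))\<^sup>2) \<le> B * (norm x)\<^sup>2"
begin

abbreviation S :: "'h \<Rightarrow> 'h" where "S \<equiv> frame_operator scaleK ip I f"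

lemma sum_squares_le:
  assumes "finite F" "F \<subseteq> I"
  shows "(\<Sum>i\<in>F. (cmod (ip x (f i)))\<^sup>2) \<le> B * (norm x)\<^sup>2"
  by (rule order_trans[OF finite_sum_le_infsum[OF square_summable assms] upper_bound]) simp

lemma L2_set_coefficients_le:
  assumes "finite F" "F \<subseteq> I"
  shows "L2_set (\<lambda>i. cmod (ip x (f i))) F \<le> sqrt B * norm x"
proof -
  have "sqrt B * norm x = sqrt (B * (norm x)\<^sup>2)"
    by (simp add: real_sqrt_mult)
  then show ?thesis
    using sum_squares_le[OF assms, of x] unfolding L2_set_def by (metis real_sqrt_le_mono)
qed

lemma norm_synthesis_le:
  assumes F: "finite F" "F \<subseteq> I" and c: "\<And>i. i \<in> F \<Longrightarrow> c i \<in> K"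
  shows "norm (\<Sum>i\<in>F. scaleK (c i) (f i)) \<le> sqrt B * L2_set (\<lambda>i. cmod (c i)) F"
proof -
  define v where "v = (\<Sum>i\<in>F. scaleK (c i) (f i))"
  have "(norm v)\<^sup>2 = cmod (ip v v)" by (simp only: ip_self norm_of_real abs_power2)
  also have "ip v v = (\<Sum>i\<in>F. c i * ip (f i) v)"
    unfolding v_def by (subst ip_sum_left) (simp add: ip_scale_left c)
  also have "cmod \<dots> \<le> (\<Sum>i\<in>F. \<bar>cmod (c i)\<bar> * \<bar>cmod (ip v (f i))\<bar>)"
    by (rule sum_norm_le) (simp add: norm_mult cmod_ip_commute)
  also have "\<dots> \<le> L2_set (\<lambda>i. cmod (c i)) F * L2_set (\<lambda>i. cmod (ip v (f i))) F"
    by (rule L2_set_mult_ineq)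
  also have "\<dots> \<le> L2_set (\<lambda>i. cmod (c i)) F * (sqrt B * norm v)"
    by (intro mult_left_mono L2_set_coefficients_le F) simp
  finally have "norm v * norm v \<le> (sqrt B * L2_set (\<lambda>i. cmod (c i)) F) * norm v"
    by (simp add: power2_eq_square mult_ac)
  then have "norm v \<le> sqrt B * L2_set (\<lambda>i. cmod (c i)) F"
    by (rule le_if_square_le_mult) (use B_pos in \<open>auto\<close>)
  then show ?thesis by (simp add: v_def)
qed

lemma frame_operator_has_sum:
  "((\<lambda>i. scaleK (ip x (f i)) (f i)) has_sum S x) I"
proof -
  have "(\<lambda>i. scaleK (ip x (f i)) (f i)) summable_on I"
  proof (rule summable_on_CauchyI)
    fix e :: real assume e: "e > 0"
    let ?q = "\<lambda>i. (cmod (ip x (f i)))\<^sup>2"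
    have "0 < e\<^sup>2 / B" using e B_pos by simp
    from infsum_finite_approximation[OF square_summable this]
    obtain F\<^sub>0 where F\<^sub>0: "finite F\<^sub>0" "F\<^sub>0 \<subseteq> I" "dist (sum ?q F\<^sub>0) (infsum ?q I) \<le> e\<^sup>2 / B"
      by blast
    have "norm (\<Sum>i\<in>F. scaleK (ip x (f i)) (f i)) \<le> e" if F: "finite F" "F \<subseteq> I - F\<^sub>0" for F
    proof -
      have "sum ?q F\<^sub>0 + sum ?q F = sum ?q (F\<^sub>0 \<union> F)"
        using F F\<^sub>0 by (intro sum.union_disjoint[symmetric]) auto
      also have "\<dots> \<le> infsum ?q I"
        using F F\<^sub>0 by (intro finite_sum_le_infsum[OF square_summable]) auto
      finally have "sum ?q F \<le> e\<^sup>2 / B"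
        using F\<^sub>0(3) unfolding dist_real_def by linarith
      then have "B * sum ?q F \<le> e\<^sup>2"
        using B_pos by (simp add: field_simps)
      then have "sqrt B * L2_set (\<lambda>i. cmod (ip x (f i))) F \<le> e"
        using e real_sqrt_le_mono by (fastforce simp: L2_set_def real_sqrt_mult[symmetric])
      then show ?thesis
        using norm_synthesis_le[of F "\<lambda>i. ip x (f i)"] F ip_in_scalars by fastforce
    qed
    then show "\<exists>F\<^sub>0. finite F\<^sub>0 \<and> F\<^sub>0 \<subseteq> I \<and> (\<forall>F. finite F \<longrightarrow> F \<subseteq> I - F\<^sub>0 \<longrightarrow>
        norm (\<Sum>i\<in>F. scaleK (ip x (f i)) (f i)) \<le> e)"
      using F\<^sub>0 by blast
  qed
  then show ?thesis
    by (simp add: frame_operator_def)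
qed

lemma ip_frame_operator_has_sum:
  "((\<lambda>i. ip x (f i) * ip (f i) y) has_sum ip (S x) y) I"
  using has_sum_bounded_linear[OF bounded_linear_ip_left frame_operator_has_sum, of x y]
  by (simp add: ip_scale_left ip_in_scalars)

lemma frame_operator_self_adjoint: "ip (S x) y = ip x (S y)"
proof -
  have "((\<lambda>i. cnj (ip y (f i) * ip (f i) x)) has_sum cnj (ip (S y) x)) I"
    by (rule has_sum_bounded_linear[OF bounded_linear_cnj ip_frame_operator_has_sum])
  moreover have "cnj (ip y (f i) * ip (f i) x) = ip x (f i) * ip (f i) y" for i
    by (metis complex_cnj_mult ip_commute mult.commute)
  ultimately have "((\<lambda>i. ip x (f i) * ip (f i) y) has_sum ip x (S y)) I"
    by (simp only: ip_commute[of x "S y"])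
  then show ?thesis
    using ip_frame_operator_has_sum has_sum_unique by blast
qed

definition coef_norm :: "'h \<Rightarrow> real" where
  "coef_norm x = sqrt (\<Sum>\<^sub>\<infinity>i\<in>I. (cmod (ip x (f i)))\<^sup>2)"

lemma coef_norm_nonneg [simp]: "0 \<le> coef_norm x"
  by (simp add: coef_norm_def infsum_nonneg)

lemma coef_norm_squared: "(coef_norm x)\<^sup>2 = Re (ip (S x) x)"
proof -
  have "ip x (f i) * ip (f i) x = of_real ((cmod (ip x (f i)))\<^sup>2)" for i
    by (metis complex_norm_square ip_commute of_real_power)
  then have "((\<lambda>i. ip x (f i) * ip (f i) x) has_sum of_real (\<Sum>\<^sub>\<infinity>i\<in>I. (cmod (ip x (f i)))\<^sup>2)) I"
    using has_sum_of_real[OF has_sum_infsum[OF square_summable[of x]], where 'a = complex] by simp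
  then have "ip (S x) x = of_real (\<Sum>\<^sub>\<infinity>i\<in>I. (cmod (ip x (f i)))\<^sup>2)"
    using ip_frame_operator_has_sum has_sum_unique by blast
  then show ?thesis
    by (simp add: coef_norm_def infsum_nonneg)
qed

lemma L2_set_le_coef_norm:
  assumes "finite F" "F \<subseteq> I"
  shows "L2_set (\<lambda>i. cmod (ip x (f i))) F \<le> coef_norm x"
  unfolding L2_set_def coef_norm_def
  by (intro real_sqrt_le_mono finite_sum_le_infsum[OF square_summable assms]) simp

lemma coef_norm_leI:
  assumes "\<And>F. finite F \<Longrightarrow> F \<subseteq> I \<Longrightarrow> L2_set (\<lambda>i. cmod (ip x (f i))) F \<le> c"
  shows "coef_norm x \<le> c"
proof -
  have c: "0 \<le> c" using assms[of "{}"] by simp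
  have "(\<Sum>\<^sub>\<infinity>i\<in>I. (cmod (ip x (f i)))\<^sup>2) \<le> c\<^sup>2"
  proof (rule infsum_le_finite_sums[OF square_summable])
    fix F assume "finite F" "F \<subseteq> I"
    from assms[OF this] show "(\<Sum>i\<in>F. (cmod (ip x (f i)))\<^sup>2) \<le> c\<^sup>2"
      unfolding L2_set_def by (metis c real_sqrt_le_iff real_sqrt_unique)
  qed
  then show ?thesis
    unfolding coef_norm_def using c real_le_lsqrt by (simp add: infsum_nonneg)
qed

lemma coef_norm_lower: "sqrt A * norm x \<le> coef_norm x"
  using real_sqrt_le_mono[OF lower_bound[of x]] by (simp add: coef_norm_def real_sqrt_mult)

lemma coef_norm_upper: "coef_norm x \<le> sqrt B * norm x"
  using real_sqrt_le_mono[OF upper_bound[of x]] by (simp add: coef_norm_def real_sqrt_mult)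

lemma cmod_ip_frame_operator_le: "cmod (ip (S x) y) \<le> coef_norm x * coef_norm y"
  by (rule cmod_has_sum_le_L2[OF ip_frame_operator_has_sum])
    (simp_all add: L2_set_le_coef_norm cmod_ip_commute[of _ y])

lemma norm_frame_operator_le: "norm (S x) \<le> B * norm x"
proof -
  have "(norm (S x))\<^sup>2 = cmod (ip (S x) (S x))" by (simp only: ip_self norm_of_real abs_power2)
  also have "\<dots> \<le> coef_norm x * coef_norm (S x)" by (rule cmod_ip_frame_operator_le)
  also have "\<dots> \<le> (sqrt B * norm x) * (sqrt B * norm (S x))"
    using B_pos by (intro mult_mono coef_norm_upper) auto
  also have "\<dots> = (sqrt B * sqrt B) * norm x * norm (S x)"
    by (simp only: mult_ac)
  finally have "norm (S x) * norm (S x) \<le> (B * norm x) * norm (S x)"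
    using B_pos by (simp add: power2_eq_square)
  then show ?thesis
    by (rule le_if_square_le_mult) (use B_pos in \<open>auto\<close>)
qed

lemma frame_operator_add: "S (x + y) = S x + S y"
  by (rule ip_eqI) (simp add: frame_operator_self_adjoint ip_add_left)

lemma frame_operator_scale: "c \<in> K \<Longrightarrow> S (scaleK c x) = scaleK c (S x)"
  by (rule ip_eqI) (simp add: frame_operator_self_adjoint ip_scale_left)

lemma frame_operator_scaleR: "S (r *\<^sub>R x) = r *\<^sub>R S x"
  using frame_operator_scale[of "of_real r" x] by (simp add: scale_of_real)

lemma frame_operator_positive: "positive_op S"
  unfolding positive_operator_def
proof (intro conjI ballI allI)
  show "bounded_linear S"
    by (rule bounded_linear_intro[where K = B])
      (simp_all add: frame_operator_add frame_operator_scaleR norm_frame_operator_le mult.commute)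
  show "0 \<le> Re (ip (S x) x)" for x
    by (simp add: coef_norm_squared[symmetric])
qed (simp_all add: frame_operator_scale frame_operator_self_adjoint)

lemma Re_ip_frame_operator_lower: "A * (norm x)\<^sup>2 \<le> Re (ip (S x) x)"
  using lower_bound[of x] by (simp add: coef_norm_squared[symmetric] coef_norm_def infsum_nonneg)

lemma frame_operator_coercive: "coercive S"
  unfolding coercive_def using A_pos Re_ip_frame_operator_lower by blast

lemma frame_operator_bij: "bij S"
  by (rule coercive_bij[OF frame_operator_positive frame_operator_coercive])

lemma frame_operator_inv [simp]: "S (op_inv S x) = x"
  using frame_operator_bij by (simp add: bij_is_surj surj_f_inv_f)

lemma norm_inverse_le: "norm (op_inv S x) \<le> norm x / A"
proof -
  let ?u = "op_inv S x"
  have "A * (norm ?u)\<^sup>2 \<le> norm x * norm ?u"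
    using Re_ip_frame_operator_lower[of ?u] norm_cauchy_schwarz[of x ?u] by (simp add: Re_ip)
  then have "A * norm ?u \<le> norm x \<or> norm ?u = 0"
    by (auto simp: power2_eq_square mult_le_cancel_right mult.assoc[symmetric])
  then show ?thesis
    using A_pos by (auto simp: field_simps)
qed

text \<open>The inverse of the Gram matrix on the range of the analysis operator has norm at most
  \<open>1 / A\<close>. This follows from \<open>\<parallel>C x\<parallel>\<^sup>2 = \<langle>S x, x\<rangle>\<close> with both factors bounded by \<open>sqrt A \<parallel>y\<parallel> \<le> \<parallel>C y\<parallel>\<close>.\<close>

lemma coef_norm_frame_operator: "coef_norm x \<le> coef_norm (S x) / A"
proof -
  have "(coef_norm x)\<^sup>2 \<le> norm (S x) * norm x"
    using norm_cauchy_schwarz[of "S x" x] by (simp add: coef_norm_squared Re_ip)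
  also have "\<dots> \<le> (coef_norm (S x) / sqrt A) * (coef_norm x / sqrt A)"
    using coef_norm_lower[of x] coef_norm_lower[of "S x"] A_pos
    by (intro mult_mono) (simp_all add: field_simps)
  also have "\<dots> = (coef_norm (S x) / A) * coef_norm x"
    using A_pos by (simp add: field_simps)
  finally have "coef_norm x * coef_norm x \<le> coef_norm (S x) / A * coef_norm x"
    by (simp only: power2_eq_square)
  then show ?thesis
    by (rule le_if_square_le_mult) (use A_pos in simp)
qed

section \<open>The lower frame bound for truncated sequences\<close>

text \<open>\<open>cutoff \<phi> J x\<close> is the vector synthesised from the coefficients of \<open>x\<close> after
  multiplication by \<open>\<phi>\<close>, and \<open>commutator \<phi> J x\<close> applies the commutator of \<open>\<phi>\<close> with the Gram
  matrix to the coefficients of \<open>x\<close>.\<close>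

definition cutoff :: "('i \<Rightarrow> real) \<Rightarrow> 'i set \<Rightarrow> 'h \<Rightarrow> 'h" where
  "cutoff \<phi> J x = (\<Sum>i\<in>J. \<phi> i *\<^sub>R scaleK (ip x (f i)) (f i))"

definition commutator :: "('i \<Rightarrow> real) \<Rightarrow> 'i set \<Rightarrow> 'h \<Rightarrow> 'i \<Rightarrow> complex" where
  "commutator \<phi> J x l = of_real (\<phi> l) * ip (S x) (f l) - ip (cutoff \<phi> J x) (f l)"

lemma ip_cutoff_has_sum:
  assumes "finite J" "J \<subseteq> I" "\<And>i. i \<in> I - J \<Longrightarrow> \<phi> i = 0"
  shows "((\<lambda>i. of_real (\<phi> i) * ip x (f i) * ip (f i) y) has_sum ip (cutoff \<phi> J x) y) I"
  by (rule has_sum_finite_neutralI[OF assms(1,2)])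
    (simp_all add: assms(3) cutoff_def ip_sum_left ip_scaleR_left ip_scale_left ip_in_scalars mult.assoc)

lemma commutator_has_sum:
  assumes "finite J" "J \<subseteq> I" "\<And>i. i \<in> I - J \<Longrightarrow> \<phi> i = 0"
  shows "((\<lambda>m. of_real (\<phi> l - \<phi> m) * ip x (f m) * ip (f m) (f l)) has_sum commutator \<phi> J x l) I"
proof -
  have "((\<lambda>m. of_real (\<phi> l) * (ip x (f m) * ip (f m) (f l)) +
      - (of_real (\<phi> m) * ip x (f m) * ip (f m) (f l))) has_sum
      of_real (\<phi> l) * ip (S x) (f l) + - ip (cutoff \<phi> J x) (f l)) I"
    by (intro has_sum_add has_sum_cmult_right has_sum_uminusI ip_cutoff_has_sum
        ip_frame_operator_has_sum assms)
  then show ?thesis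
    by (simp add: commutator_def algebra_simps)
qed

text \<open>Let \<open>C\<close> be the analysis operator, so that \<open>S = C\<^sup>* C\<close>, and let \<open>z\<close> be the cutoff of \<open>x'\<close>. The
  truncated sequence \<open>\<phi> C x = \<phi> C C\<^sup>* C x'\<close> differs from \<open>C z\<close> by the commutator at \<open>x'\<close>. It therefore
  suffices to bound \<open>C z\<close>, and \<open>S z\<close> differs from the cutoff of \<open>x\<close> by \<open>C\<^sup>*\<close> of the same
  commutator. The coefficients of the cutoff of \<open>x\<close> are \<open>\<phi> C S x\<close> up to the commutator at
  \<open>x\<close>. Altogether \<open>S\<close> is bounded below by \<open>A\<close> on truncated sequences, up to commutators.\<close>

lemma truncated_lower_bound:
  assumes J: "finite J" "J \<subseteq> I" "\<And>i. i \<in> I - J \<Longrightarrow> \<phi> i = 0" and \<phi>: "\<And>i. 0 \<le> \<phi> i"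
    and x: "S x' = x"
    and E: "\<And>F. finite F \<Longrightarrow> F \<subseteq> I \<Longrightarrow> L2_set (\<lambda>l. cmod (commutator \<phi> J x l)) F \<le> E"
    and E': "\<And>F. finite F \<Longrightarrow> F \<subseteq> I \<Longrightarrow> L2_set (\<lambda>l. cmod (commutator \<phi> J x' l)) F \<le> E'"
  shows "L2_set (\<lambda>l. \<phi> l * cmod (ip x (f l))) J
    \<le> (L2_set (\<lambda>l. \<phi> l * cmod (ip (S x) (f l))) J + E) / A + 2 * E'"
proof -
  define z where "z = cutoff \<phi> J x'"
  define w where "w = cutoff \<phi> J x - S z"
  define u where "u = op_inv S (cutoff \<phi> J x)"
  have E0: "0 \<le> E" "0 \<le> E'" using E[of "{}"] E'[of "{}"] by simp_all
  have e: "commutator \<phi> J x' l = of_real (\<phi> l) * ip x (f l) - ip z (f l)" for l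
    by (simp add: commutator_def x z_def)
  have "cmod (ip w z) \<le> E' * coef_norm z"
  proof (rule cmod_has_sum_le_L2[where u = "commutator \<phi> J x'"])
    have "((\<lambda>l. of_real (\<phi> l) * ip x (f l) * ip (f l) z + - (ip z (f l) * ip (f l) z)) has_sum
        ip (cutoff \<phi> J x) z + - ip (S z) z) I"
      by (intro has_sum_add has_sum_uminusI ip_cutoff_has_sum ip_frame_operator_has_sum J)
    then show "((\<lambda>l. commutator \<phi> J x' l * ip (f l) z) has_sum ip w z) I"
      by (simp add: e w_def ip_diff_left algebra_simps)
    show "L2_set (\<lambda>i. cmod (ip (f i) z)) F \<le> coef_norm z" if "finite F" "F \<subseteq> I" for F
      using L2_set_le_coef_norm[OF that, of z] by (simp add: cmod_ip_commute[of _ z])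
  qed (rule E')
  moreover have "cmod (ip (cutoff \<phi> J x) z) \<le> coef_norm u * coef_norm z"
    using cmod_ip_frame_operator_le[of u z] by (simp add: u_def)
  moreover have "(coef_norm z)\<^sup>2 = Re (ip (cutoff \<phi> J x) z) - Re (ip w z)"
    by (simp add: coef_norm_squared w_def ip_diff_left)
  moreover have "Re (ip (cutoff \<phi> J x) z) \<le> cmod (ip (cutoff \<phi> J x) z)" "- Re (ip w z) \<le> cmod (ip w z)"
    using complex_Re_le_cmod abs_Re_le_cmod[of "ip w z"] by (auto simp: abs_le_iff)
  ultimately have "coef_norm z * coef_norm z \<le> (coef_norm u + E') * coef_norm z"
    by (simp add: power2_eq_square algebra_simps)
  then have z: "coef_norm z \<le> coef_norm u + E'"
    by (rule le_if_square_le_mult) (use E0 in simp)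
  have u: "coef_norm u \<le> coef_norm (cutoff \<phi> J x) / A"
    using coef_norm_frame_operator[of u] by (simp add: u_def)
  have cut: "coef_norm (cutoff \<phi> J x) \<le> L2_set (\<lambda>l. \<phi> l * cmod (ip (S x) (f l))) J + E"
  proof (rule coef_norm_leI)
    fix F assume F: "finite F" "F \<subseteq> I"
    have "L2_set (\<lambda>l. cmod (ip (cutoff \<phi> J x) (f l))) F
        \<le> L2_set (\<lambda>l. \<phi> l * cmod (ip (S x) (f l)) + cmod (commutator \<phi> J x l)) F"
    proof (rule L2_set_mono)
      fix l
      have "ip (cutoff \<phi> J x) (f l) = of_real (\<phi> l) * ip (S x) (f l) - commutator \<phi> J x l"
        by (simp add: commutator_def)
      then show "cmod (ip (cutoff \<phi> J x) (f l)) \<le> \<phi> l * cmod (ip (S x) (f l)) + cmod (commutator \<phi> J x l)"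
        using norm_triangle_ineq4[of "of_real (\<phi> l) * ip (S x) (f l)" "commutator \<phi> J x l"] \<phi>[of l]
        by (simp add: norm_mult)
    qed simp
    also have "\<dots> \<le> L2_set (\<lambda>l. \<phi> l * cmod (ip (S x) (f l))) F + L2_set (\<lambda>l. cmod (commutator \<phi> J x l)) F"
      by (rule L2_set_triangle_ineq)
    also have "\<dots> \<le> L2_set (\<lambda>l. \<phi> l * cmod (ip (S x) (f l))) J + E"
      using F J by (intro add_mono E L2_set_mono_neutral) auto
    finally show "L2_set (\<lambda>l. cmod (ip (cutoff \<phi> J x) (f l))) F
        \<le> L2_set (\<lambda>l. \<phi> l * cmod (ip (S x) (f l))) J + E" .
  qed
  have "L2_set (\<lambda>l. \<phi> l * cmod (ip x (f l))) J
      \<le> L2_set (\<lambda>l. cmod (ip z (f l)) + cmod (commutator \<phi> J x' l)) J"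
  proof (rule L2_set_mono)
    fix l
    have "of_real (\<phi> l) * ip x (f l) = ip z (f l) + commutator \<phi> J x' l"
      by (simp add: e)
    then show "\<phi> l * cmod (ip x (f l)) \<le> cmod (ip z (f l)) + cmod (commutator \<phi> J x' l)"
      using norm_triangle_ineq[of "ip z (f l)" "commutator \<phi> J x' l"] \<phi>[of l]
      by (metis abs_of_nonneg norm_mult norm_of_real)
  qed (simp add: \<phi>)
  also have "\<dots> \<le> L2_set (\<lambda>l. cmod (ip z (f l))) J + L2_set (\<lambda>l. cmod (commutator \<phi> J x' l)) J"
    by (rule L2_set_triangle_ineq)
  also have "\<dots> \<le> coef_norm z + E'"
    using J by (intro add_mono E' L2_set_le_coef_norm) auto
  also have "\<dots> \<le> coef_norm (cutoff \<phi> J x) / A + 2 * E'"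
    using z u by simp
  also have "\<dots> \<le> (L2_set (\<lambda>l. \<phi> l * cmod (ip (S x) (f l))) J + E) / A + 2 * E'"
    using cut A_pos by (simp add: divide_right_mono)
  finally show ?thesis .
qed

end

section \<open>Schur's test and nonnegative infinite sums\<close>

lemma L2_set_sum_le: "L2_set (\<lambda>l. \<Sum>j\<in>J. u j l) F \<le> (\<Sum>j\<in>J. L2_set (u j) F)"
proof (induction J rule: infinite_finite_induct)
  case (insert j J)
  then show ?case
    using L2_set_triangle_ineq[of "u j" "\<lambda>l. \<Sum>j\<in>J. u j l" F] by simp
qed (simp_all add: L2_set_def)

lemma schur_test:
  fixes k :: "'a \<Rightarrow> 'b \<Rightarrow> real"
  assumes k: "\<And>l m. l \<in> F \<Longrightarrow> m \<in> F' \<Longrightarrow> 0 \<le> k l m"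
    and row: "\<And>l. l \<in> F \<Longrightarrow> (\<Sum>m\<in>F'. k l m) \<le> R"
    and column: "\<And>m. m \<in> F' \<Longrightarrow> (\<Sum>l\<in>F. k l m) \<le> R"
    and R: "0 \<le> R"
  shows "L2_set (\<lambda>l. \<Sum>m\<in>F'. k l m * c m) F \<le> R * L2_set c F'"
proof -
  have "(\<Sum>m\<in>F'. k l m * c m)\<^sup>2 \<le> R * (\<Sum>m\<in>F'. k l m * (c m)\<^sup>2)" if l: "l \<in> F" for l
  proof -
    have "(\<Sum>m\<in>F'. k l m * c m)\<^sup>2 = (\<Sum>m\<in>F'. sqrt (k l m) * (sqrt (k l m) * c m))\<^sup>2"
      using k[OF l] by (intro arg_cong[where f = "\<lambda>x. x\<^sup>2"] sum.cong) (simp_all add: mult.assoc[symmetric])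
    also have "\<dots> \<le> (\<Sum>m\<in>F'. (sqrt (k l m))\<^sup>2) * (\<Sum>m\<in>F'. (sqrt (k l m) * c m)\<^sup>2)"
      by (rule Cauchy_Schwarz_ineq_sum)
    also have "\<dots> = (\<Sum>m\<in>F'. k l m) * (\<Sum>m\<in>F'. k l m * (c m)\<^sup>2)"
      using k[OF l] by (intro arg_cong2[where f = "(*)"] sum.cong) (simp_all add: power_mult_distrib)
    also have "\<dots> \<le> R * (\<Sum>m\<in>F'. k l m * (c m)\<^sup>2)"
      using k[OF l] by (intro mult_right_mono row[OF l] sum_nonneg) auto
    finally show ?thesis .
  qed
  then have "(\<Sum>l\<in>F. (\<Sum>m\<in>F'. k l m * c m)\<^sup>2) \<le> (\<Sum>l\<in>F. R * (\<Sum>m\<in>F'. k l m * (c m)\<^sup>2))"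
    by (rule sum_mono)
  also have "\<dots> = R * (\<Sum>m\<in>F'. (\<Sum>l\<in>F. k l m) * (c m)\<^sup>2)"
    by (subst sum_distrib_left[symmetric], subst sum.swap) (simp add: sum_distrib_right)
  also have "\<dots> \<le> R * (\<Sum>m\<in>F'. R * (c m)\<^sup>2)"
    by (intro mult_left_mono sum_mono mult_right_mono column R) auto
  also have "\<dots> = R\<^sup>2 * (\<Sum>m\<in>F'. (c m)\<^sup>2)"
    by (simp add: sum_distrib_left power2_eq_square mult.assoc)
  finally have "sqrt (\<Sum>l\<in>F. (\<Sum>m\<in>F'. k l m * c m)\<^sup>2) \<le> sqrt (R\<^sup>2 * (\<Sum>m\<in>F'. (c m)\<^sup>2))"
    by (rule real_sqrt_le_mono)
  then show ?thesis
    using R by (simp add: L2_set_def real_sqrt_mult)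
qed

lemma nonneg_summable_onI:
  fixes q :: "'a \<Rightarrow> real"
  assumes "\<And>x. x \<in> X \<Longrightarrow> 0 \<le> q x" "\<And>F. finite F \<Longrightarrow> F \<subseteq> X \<Longrightarrow> sum q F \<le> c"
  shows "q summable_on X"
  using assms by (intro nonneg_bdd_above_summable_on) (auto simp: bdd_above_def)

lemma summable_on_le:
  fixes p q :: "'a \<Rightarrow> real"
  assumes "q summable_on X" "\<And>x. x \<in> X \<Longrightarrow> 0 \<le> p x" "\<And>x. x \<in> X \<Longrightarrow> p x \<le> q x"
  shows "p summable_on X"
proof (rule nonneg_summable_onI)
  fix F assume F: "finite F" "F \<subseteq> X"
  have "sum p F \<le> sum q F" using F assms by (intro sum_mono) auto
  also have "\<dots> \<le> infsum q X"
    using F assms(2,3) by (intro finite_sum_le_infsum assms(1)) (auto intro: order_trans)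
  finally show "sum p F \<le> infsum q X" .
qed (rule assms)

lemma has_sum_sum:
  fixes u :: "'a \<Rightarrow> 'b \<Rightarrow> real"
  assumes "finite F" "\<And>g. g \<in> F \<Longrightarrow> (u g has_sum s g) X"
  shows "((\<lambda>h. \<Sum>g\<in>F. u g h) has_sum sum s F) X"
  using assms by (induction F rule: finite_induct) (auto intro: has_sum_add)

lemma summable_on_sum:
  fixes u :: "'a \<Rightarrow> 'b \<Rightarrow> real"
  assumes "finite F" "\<And>g. g \<in> F \<Longrightarrow> u g summable_on X"
  shows "(\<lambda>h. \<Sum>g\<in>F. u g h) summable_on X"
  by (rule has_sum_imp_summable, rule has_sum_sum[OF assms(1)], rule has_sum_infsum) (rule assms(2))

lemma infsum_sum:
  fixes u :: "'a \<Rightarrow> 'b \<Rightarrow> real"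
  assumes "finite F" "\<And>g. g \<in> F \<Longrightarrow> u g summable_on X"
  shows "(\<Sum>\<^sub>\<infinity>h\<in>X. \<Sum>g\<in>F. u g h) = (\<Sum>g\<in>F. infsum (u g) X)"
  by (rule infsumI, rule has_sum_sum) (use assms in auto)

section \<open>Abelian groups with a length function\<close>

text \<open>The properties of the index group on which the argument rests. Doubling is assumed
  for radii at least \<open>1\<close>, where a ball of the index group contains all torsion elements.\<close>

locale length_group = comm_group G for G (structure) +
  fixes len :: "'a \<Rightarrow> real" and D :: real
  assumes len_nonneg: "x \<in> carrier G \<Longrightarrow> 0 \<le> len x"
    and len_one: "len \<one> = 0"
    and len_inv: "x \<in> carrier G \<Longrightarrow> len (inv x) = len x"
    and len_mult: "x \<in> carrier G \<Longrightarrow> y \<in> carrier G \<Longrightarrow> len (x \<otimes> y) \<le> len x + len y"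
    and finite_ball: "finite {x \<in> carrier G. len x \<le> R}"
    and doubling: "1 \<le> R \<Longrightarrow> real (card {x \<in> carrier G. len x \<le> 4 * R}) \<le> D * real (card {x \<in> carrier G. len x \<le> R})"
begin

abbreviation gdiff :: "'a \<Rightarrow> 'a \<Rightarrow> 'a" where "gdiff x y \<equiv> x \<otimes> inv y"

lemma mult_gdiff_cancel: "x \<in> carrier G \<Longrightarrow> y \<in> carrier G \<Longrightarrow> gdiff x y \<otimes> y = x"
  by (simp add: m_assoc)

lemma gdiff_gdiff_self:
  "x \<in> carrier G \<Longrightarrow> y \<in> carrier G \<Longrightarrow> gdiff x (gdiff x y) = y"
  using m_lcomm[of x y "inv x"] by (simp add: inv_mult_group)

lemma gdiff_gdiff_right:
  assumes "x \<in> carrier G" "y \<in> carrier G" "z \<in> carrier G"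
  shows "gdiff (gdiff x z) (gdiff y z) = gdiff x y"
proof -
  have "gdiff (gdiff x z) (gdiff y z) = x \<otimes> (inv z \<otimes> z) \<otimes> inv y"
    using assms by (simp add: inv_mult_group m_assoc[symmetric]) (simp add: m_assoc)
  then show ?thesis using assms by simp
qed

lemma gdiff_mult_gdiff:
  assumes "x \<in> carrier G" "y \<in> carrier G" "u \<in> carrier G" "v \<in> carrier G"
  shows "gdiff x y \<otimes> gdiff u v = gdiff (gdiff x v) (gdiff y u)"
  using assms by (simp add: inv_mult_group m_ac)

lemma gdiff_gdiff_left:
  assumes "x \<in> carrier G" "u \<in> carrier G" "v \<in> carrier G"
  shows "gdiff (gdiff x v) (gdiff x u) = gdiff u v"
  using gdiff_mult_gdiff[of x x u v] assms by simp

lemma len_gdiff_commute: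
  "x \<in> carrier G \<Longrightarrow> y \<in> carrier G \<Longrightarrow> len (gdiff x y) = len (gdiff y x)"
  by (metis inv_closed inv_inv inv_mult_group len_inv m_closed)

lemma len_gdiff_le: "x \<in> carrier G \<Longrightarrow> y \<in> carrier G \<Longrightarrow> len (gdiff x y) \<le> len x + len y"
  using len_mult[of x "inv y"] by (simp add: len_inv)

lemma len_diff_le:
  assumes "x \<in> carrier G" "y \<in> carrier G"
  shows "\<bar>len x - len y\<bar> \<le> len (gdiff x y)"
proof -
  have "len x \<le> len (gdiff x y) + len y" "len y \<le> len (gdiff y x) + len x"
    using len_mult[of "gdiff x y" y] len_mult[of "gdiff y x" x] assms by (simp_all add: mult_gdiff_cancel)
  then show ?thesis using len_gdiff_commute[OF assms] by linarith
qed

lemma bij_gdiff_left: "g \<in> carrier G \<Longrightarrow> bij_betw (\<lambda>h. gdiff g h) (carrier G) (carrier G)"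
  by (rule bij_betwI[where g = "\<lambda>h. gdiff g h"]) (auto simp: gdiff_gdiff_self)

lemma bij_gdiff_right: "g \<in> carrier G \<Longrightarrow> bij_betw (\<lambda>h. gdiff h g) (carrier G) (carrier G)"
  by (rule bij_betwI[where g = "\<lambda>h. h \<otimes> g"]) (auto simp: m_assoc)

lemma bij_mult_left: "g \<in> carrier G \<Longrightarrow> bij_betw ((\<otimes>) g) (carrier G) (carrier G)"
  by (rule bij_betwI[where g = "(\<otimes>) (inv g)"]) (auto simp: m_assoc[symmetric])

lemma sum_translate_le_infsum:
  fixes q :: "'a \<Rightarrow> real"
  assumes "q summable_on carrier G" "\<And>g. g \<in> carrier G \<Longrightarrow> 0 \<le> q g"
    and b: "bij_betw b (carrier G) (carrier G)" and F: "finite F" "F \<subseteq> carrier G"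
  shows "(\<Sum>g\<in>F. q (b g)) \<le> infsum q (carrier G)"
proof -
  have "inj_on b F" using b F(2) by (meson bij_betw_imp_inj_on inj_on_subset)
  then have "(\<Sum>g\<in>F. q (b g)) = sum q (b ` F)"
    by (simp add: sum.reindex)
  also have "\<dots> \<le> infsum q (carrier G)"
    using b F by (intro finite_sum_le_infsum assms) (auto simp: bij_betw_def assms(2))
  finally show ?thesis .
qed

text \<open>The obvious argument would sum the inequality over the group, which presupposes the
  conclusion. Summation over sets with at most \<open>N\<close> elements avoids this: the supremum of these sums
  is finite because \<open>t\<close> is bounded, translation does not change the class of sets, and the bound
  obtained does not depend on \<open>N\<close>.\<close>

lemma summable_of_convolution_inequality:
  fixes s t y :: "'a \<Rightarrow> real"
  assumes s: "\<And>g. g \<in> carrier G \<Longrightarrow> 0 \<le> s g"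
      "\<And>F. finite F \<Longrightarrow> F \<subseteq> carrier G \<Longrightarrow> sum s F \<le> 1 / 2"
    and y: "\<And>F. finite F \<Longrightarrow> F \<subseteq> carrier G \<Longrightarrow> sum y F \<le> Y"
    and t: "\<And>g. g \<in> carrier G \<Longrightarrow> 0 \<le> t g" "\<And>g. g \<in> carrier G \<Longrightarrow> t g \<le> T"
    and le: "\<And>g. g \<in> carrier G \<Longrightarrow> t g \<le> y g + (\<Sum>\<^sub>\<infinity>h\<in>carrier G. s h * t (gdiff g h))"
  shows "t summable_on carrier G"
proof (rule nonneg_summable_onI)
  fix F\<^sub>0 assume F\<^sub>0: "finite F\<^sub>0" "F\<^sub>0 \<subseteq> carrier G"
  define N where "N = card F\<^sub>0"
  define \<F> where "\<F> = {F. finite F \<and> F \<subseteq> carrier G \<and> card F \<le> N}"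
  define \<tau> where "\<tau> = (SUP F\<in>\<F>. sum t F)"
  have T: "0 \<le> T" using t[of \<one>] by simp
  have ss: "s summable_on carrier G"
    by (rule nonneg_summable_onI) (fact s)+
  have bdd: "bdd_above (sum t ` \<F>)"
  proof (rule bdd_aboveI2)
    fix F assume F: "F \<in> \<F>"
    have "sum t F \<le> real (card F) * T"
      using F t(2) by (intro sum_bounded_above) (auto simp: \<F>_def)
    also have "\<dots> \<le> real N * T"
      using F T by (intro mult_right_mono) (auto simp: \<F>_def)
    finally show "sum t F \<le> real N * T" .
  qed
  have le_\<tau>: "sum t F \<le> \<tau>" if "F \<in> \<F>" for F
    unfolding \<tau>_def using bdd that by (rule cSUP_upper2) simp
  have \<tau>0: "0 \<le> \<tau>" using le_\<tau>[of "{}"] by (simp add: \<F>_def)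
  have conv: "(\<lambda>h. s h * t (gdiff g h)) summable_on carrier G" if "g \<in> carrier G" for g
    by (rule summable_on_le[OF summable_on_cmult_left[OF ss, of T]])
      (use that s t in \<open>auto intro!: mult_left_mono\<close>)
  have "sum t F \<le> Y + \<tau> / 2" if F: "F \<in> \<F>" for F
  proof -
    have F': "finite F" "F \<subseteq> carrier G" "card F \<le> N" using F by (auto simp: \<F>_def)
    have "sum t F \<le> (\<Sum>g\<in>F. y g + (\<Sum>\<^sub>\<infinity>h\<in>carrier G. s h * t (gdiff g h)))"
      using F' by (intro sum_mono le) auto
    also have "\<dots> = sum y F + (\<Sum>g\<in>F. \<Sum>\<^sub>\<infinity>h\<in>carrier G. s h * t (gdiff g h))"
      by (simp add: sum.distrib)
    also have "(\<Sum>g\<in>F. \<Sum>\<^sub>\<infinity>h\<in>carrier G. s h * t (gdiff g h))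
        = (\<Sum>\<^sub>\<infinity>h\<in>carrier G. \<Sum>g\<in>F. s h * t (gdiff g h))"
      using F' conv by (intro infsum_sum[symmetric]) auto
    also have "\<dots> \<le> (\<Sum>\<^sub>\<infinity>h\<in>carrier G. s h * \<tau>)"
    proof (rule infsum_mono)
      show "(\<lambda>h. \<Sum>g\<in>F. s h * t (gdiff g h)) summable_on carrier G"
        using F' conv by (intro summable_on_sum) auto
      show "(\<lambda>h. s h * \<tau>) summable_on carrier G"
        by (rule summable_on_cmult_left[OF ss])
      fix h assume h: "h \<in> carrier G"
      have "inj_on (\<lambda>g. gdiff g h) F"
        using bij_gdiff_right[OF h] F'(2) by (meson bij_betw_imp_inj_on inj_on_subset)
      then have "(\<Sum>g\<in>F. t (gdiff g h)) = sum t ((\<lambda>g. gdiff g h) ` F)"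
        by (simp add: sum.reindex)
      also have "\<dots> \<le> \<tau>"
        using F' h card_image_le[OF F'(1), of "\<lambda>g. gdiff g h"] by (intro le_\<tau>) (auto simp: \<F>_def)
      finally show "(\<Sum>g\<in>F. s h * t (gdiff g h)) \<le> s h * \<tau>"
        using s(1)[OF h] by (simp add: sum_distrib_left[symmetric] mult_left_mono)
    qed
    also have "\<dots> = infsum s (carrier G) * \<tau>"
      by (rule infsum_cmult_left) (rule ss)
    also have "\<dots> \<le> 1 / 2 * \<tau>"
      by (intro mult_right_mono \<tau>0 infsum_le_finite_sums ss s(2))
    finally show ?thesis using y[OF F'(1,2)] by simp
  qed
  moreover have "{} \<in> \<F>" by (simp add: \<F>_def)
  ultimately have "(SUP F\<in>\<F>. sum t F) \<le> Y + \<tau> / 2"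
    by (intro cSUP_least) auto
  then have "\<tau> \<le> Y + \<tau> / 2" by (simp only: \<tau>_def[symmetric])
  moreover have "sum t F\<^sub>0 \<le> \<tau>"
    using F\<^sub>0 by (intro le_\<tau>) (simp add: \<F>_def N_def)
  ultimately show "sum t F\<^sub>0 \<le> 2 * Y" by simp
qed (rule t)

lemma finite_translated_ball:
  assumes b: "bij_betw b (carrier G) (carrier G)"
  shows "finite {g \<in> carrier G. len (b g) \<le> L}"
proof -
  have "{g \<in> carrier G. len (b g) \<le> L} \<subseteq> inv_into (carrier G) b ` {g \<in> carrier G. len g \<le> L}"
  proof
    fix g assume "g \<in> {g \<in> carrier G. len (b g) \<le> L}"
    then show "g \<in> inv_into (carrier G) b ` {g \<in> carrier G. len g \<le> L}"
      using b by (intro image_eqI[of _ _ "b g"]) (auto simp: bij_betw_def)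
  qed
  then show "finite {g \<in> carrier G. len (b g) \<le> L}"
    using finite_ball by (meson finite_imageI finite_subset)
qed

section \<open>Tent functions\<close>

text \<open>The Lipschitz constant \<open>1 / L\<close> is what makes commutators with tents small for large \<open>L\<close>.\<close>

definition tent :: "real \<Rightarrow> 'a \<Rightarrow> real" where
  "tent L g = max 0 (1 - len g / L)"

text \<open>The constant value of the sum of all translates of the tent.\<close>

definition tent_mass :: "real \<Rightarrow> real" where
  "tent_mass L = (\<Sum>g | g \<in> carrier G \<and> len g \<le> L. tent L g)"

lemma tent_nonneg [simp]: "0 \<le> tent L g"
  by (simp add: tent_def)

lemma tent_le_one: "0 < L \<Longrightarrow> g \<in> carrier G \<Longrightarrow> tent L g \<le> 1"
  by (simp add: tent_def len_nonneg)

lemma tent_one: "tent L \<one> = 1"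
  by (simp add: tent_def len_one)

lemma tent_eq_0: "0 < L \<Longrightarrow> L \<le> len g \<Longrightarrow> tent L g = 0"
  by (simp add: tent_def)

lemma tent_gdiff_commute:
  "x \<in> carrier G \<Longrightarrow> y \<in> carrier G \<Longrightarrow> tent L (gdiff x y) = tent L (gdiff y x)"
  by (simp add: tent_def len_gdiff_commute[of x y])

lemma tent_lipschitz:
  assumes "0 < L" "x \<in> carrier G" "y \<in> carrier G"
  shows "\<bar>tent L x - tent L y\<bar> \<le> min 1 (len (gdiff x y) / L)"
proof -
  have "\<bar>tent L x - tent L y\<bar> \<le> \<bar>len x / L - len y / L\<bar>"
    by (auto simp: tent_def max_def abs_if)
  also have "\<dots> = \<bar>len x - len y\<bar> / L"
    using assms(1) by (simp add: diff_divide_distrib[symmetric])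
  also have "\<dots> \<le> len (gdiff x y) / L"
    using len_diff_le[OF assms(2,3)] assms(1) by (simp add: divide_right_mono)
  finally have "\<bar>tent L x - tent L y\<bar> \<le> len (gdiff x y) / L" .
  moreover have "\<bar>tent L x - tent L y\<bar> \<le> 1"
    using tent_le_one[OF assms(1), of x] tent_le_one[OF assms(1), of y] assms tent_nonneg[of L x] tent_nonneg[of L y]
    by linarith
  ultimately show ?thesis by simp
qed

lemma tent_sum_eq:
  assumes L: "0 < L" and b: "bij_betw b (carrier G) (carrier G)"
    and F: "finite F" "F \<subseteq> carrier G" "\<And>g. g \<in> carrier G \<Longrightarrow> len (b g) \<le> L \<Longrightarrow> g \<in> F"
  shows "(\<Sum>g\<in>F. tent L (b g)) = tent_mass L"
proof -
  let ?B = "{g \<in> carrier G. len g \<le> L}"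
  have "inj_on b F" using b F(2) by (meson bij_betw_imp_inj_on inj_on_subset)
  then have "(\<Sum>g\<in>F. tent L (b g)) = sum (tent L) (b ` F)"
    by (simp add: sum.reindex)
  also have "\<dots> = sum (tent L) ?B"
  proof (rule sum.mono_neutral_right)
    show "?B \<subseteq> b ` F"
    proof
      fix g assume g: "g \<in> ?B"
      then obtain h where "h \<in> carrier G" "g = b h"
        using b by (auto simp: bij_betw_def)
      then show "g \<in> b ` F" using g F(3) by auto
    qed
    show "\<forall>g\<in>b ` F - ?B. tent L g = 0"
      using b F(2) by (auto simp: bij_betw_def intro!: tent_eq_0[OF L])
  qed (use F in auto)
  finally show ?thesis by (simp add: tent_mass_def)
qed

lemma tent_sum_le:
  assumes L: "0 < L" and b: "bij_betw b (carrier G) (carrier G)" and F: "finite F" "F \<subseteq> carrier G"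
  shows "(\<Sum>g\<in>F. tent L (b g)) \<le> tent_mass L"
proof -
  have fin: "finite {g \<in> carrier G. len (b g) \<le> L}"
    by (rule finite_translated_ball[OF b])
  have "(\<Sum>g\<in>F. tent L (b g)) \<le> (\<Sum>g\<in>F \<union> {g \<in> carrier G. len (b g) \<le> L}. tent L (b g))"
    using F fin by (intro sum_mono2) auto
  also have "\<dots> = tent_mass L"
    using F fin by (intro tent_sum_eq[OF L b]) auto
  finally show ?thesis .
qed

text \<open>The tent is at least \<open>1 / 2\<close> on the ball of radius \<open>L / 2\<close>, which by doubling is comparable to
  the ball of radius \<open>2 L\<close>.\<close>

lemma ball_card_le_tent_mass:
  assumes "2 \<le> L"
  shows "real (card {x \<in> carrier G. len x \<le> 2 * L}) \<le> 2 * D * tent_mass L" "0 < tent_mass L" "0 \<le> D"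
proof -
  let ?B = "\<lambda>R. {x \<in> carrier G. len x \<le> R}"
  have "real (card (?B (L / 2))) * (1 / 2) = (\<Sum>g\<in>?B (L / 2). 1 / 2)" by simp
  also have "\<dots> \<le> (\<Sum>g\<in>?B (L / 2). tent L g)"
    using assms by (intro sum_mono) (auto simp: tent_def field_simps)
  also have "\<dots> \<le> tent_mass L"
    unfolding tent_mass_def using assms by (intro sum_mono2 finite_ball) auto
  finally have half: "real (card (?B (L / 2))) \<le> 2 * tent_mass L" by simp
  have "\<one> \<in> ?B (L / 2)" using assms by (simp add: len_one)
  then have pos: "0 < card (?B (L / 2))"
    using finite_ball[of "L / 2"] by (simp only: card_gt_0_iff) blast
  then show "0 < tent_mass L" using half by linarith
  have dbl: "real (card (?B (2 * L))) \<le> D * real (card (?B (L / 2)))"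
    using doubling[of "L / 2"] assms by simp
  show D: "0 \<le> D"
  proof (rule ccontr)
    assume "\<not> 0 \<le> D"
    then have "D * real (card (?B (L / 2))) < 0" using pos by (simp add: mult_neg_pos)
    then show False using dbl by linarith
  qed
  show "real (card (?B (2 * L))) \<le> 2 * D * tent_mass L"
    using dbl mult_left_mono[OF half D] by simp
qed

end

section \<open>Windows on the index set\<close>

locale localized_frame = frame K scaleK ip I f A B + length_group G len D
  for K and scaleK :: "complex \<Rightarrow> 'h::{real_inner, complete_space} \<Rightarrow> 'h" and ip :: "'h \<Rightarrow> 'h \<Rightarrow> complex"
    and I :: "'i set" and f :: "'i \<Rightarrow> 'h" and A B :: real
    and G :: "('g, 'x) monoid_scheme" (structure) and len :: "'g \<Rightarrow> real" and D :: real +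
  fixes a :: "'i \<Rightarrow> 'g" and \<mu> :: real and r :: "'g \<Rightarrow> real"
  assumes index_in_carrier: "i \<in> I \<Longrightarrow> a i \<in> carrier G"
    and finite_fibre: "g \<in> carrier G \<Longrightarrow> finite {i \<in> I. a i = g}"
    and card_fibre: "g \<in> carrier G \<Longrightarrow> real (card {i \<in> I. a i = g}) \<le> \<mu>"
    and r_nonneg: "g \<in> carrier G \<Longrightarrow> 0 \<le> r g"
    and r_summable: "r summable_on carrier G"
    and gram_le: "i \<in> I \<Longrightarrow> j \<in> I \<Longrightarrow> cmod (ip (f i) (f j)) \<le> r (gdiff (a i) (a j))"
begin

lemma \<mu>_nonneg: "0 \<le> \<mu>"
  using card_fibre[of \<one>] by (meson of_nat_0_le_iff one_closed order_trans)

lemma sum_over_indices_le: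
  fixes q :: "'g \<Rightarrow> real"
  assumes q: "q summable_on carrier G" "\<And>g. g \<in> carrier G \<Longrightarrow> 0 \<le> q g"
    and b: "bij_betw b (carrier G) (carrier G)" and F: "finite F" "F \<subseteq> I"
  shows "(\<Sum>i\<in>F. q (b (a i))) \<le> \<mu> * infsum q (carrier G)"
proof -
  have aF: "a ` F \<subseteq> carrier G" using F index_in_carrier by auto
  have "(\<Sum>i\<in>F. q (b (a i))) = (\<Sum>g\<in>a ` F. \<Sum>i | i \<in> F \<and> a i = g. q (b (a i)))"
    by (rule sum.image_gen[OF F(1)])
  also have "\<dots> \<le> (\<Sum>g\<in>a ` F. \<mu> * q (b g))"
  proof (rule sum_mono)
    fix g assume "g \<in> a ` F"
    then have g: "g \<in> carrier G" using aF by auto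
    have "card {i. i \<in> F \<and> a i = g} \<le> card {i \<in> I. a i = g}"
      using F by (intro card_mono finite_fibre g) auto
    then have c: "real (card {i. i \<in> F \<and> a i = g}) \<le> \<mu>"
      using card_fibre[OF g] by linarith
    have "(\<Sum>i | i \<in> F \<and> a i = g. q (b (a i))) = real (card {i. i \<in> F \<and> a i = g}) * q (b g)"
      by simp
    also have "\<dots> \<le> \<mu> * q (b g)"
      using b g by (intro mult_right_mono c q(2)) (auto simp: bij_betw_def)
    finally show "(\<Sum>i | i \<in> F \<and> a i = g. q (b (a i))) \<le> \<mu> * q (b g)" .
  qed
  also have "\<dots> = \<mu> * (\<Sum>g\<in>a ` F. q (b g))"
    by (simp add: sum_distrib_left)
  also have "\<dots> \<le> \<mu> * infsum q (carrier G)"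
    using F aF by (intro mult_left_mono \<mu>_nonneg sum_translate_le_infsum q b) auto
  finally show ?thesis .
qed

definition window :: "real \<Rightarrow> 'g \<Rightarrow> 'i \<Rightarrow> real" where
  "window L j i = tent L (gdiff (a i) j)"

definition near :: "real \<Rightarrow> 'g \<Rightarrow> 'i set" where
  "near L j = {i \<in> I. len (gdiff (a i) j) \<le> L}"

definition local_norm :: "real \<Rightarrow> 'h \<Rightarrow> 'g \<Rightarrow> real" where
  "local_norm L x j = L2_set (\<lambda>l. window L j l * cmod (ip x (f l))) (near L j)"

lemma window_nonneg [simp]: "0 \<le> window L j i"
  by (simp add: window_def)

lemma near_subset: "near L j \<subseteq> I"
  by (auto simp: near_def)

lemma finite_near: "j \<in> carrier G \<Longrightarrow> finite (near L j)"
proof -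
  assume j: "j \<in> carrier G"
  have "near L j \<subseteq> (\<Union>g\<in>{g \<in> carrier G. len (gdiff g j) \<le> L}. {i \<in> I. a i = g})"
    using index_in_carrier by (auto simp: near_def)
  moreover have "finite \<dots>"
    using finite_translated_ball[OF bij_gdiff_right[OF j]] finite_fibre by blast
  ultimately show ?thesis by (rule finite_subset)
qed

lemma window_eq_0: "0 < L \<Longrightarrow> i \<in> I - near L j \<Longrightarrow> window L j i = 0"
  by (auto simp: near_def window_def intro!: tent_eq_0)

lemma local_norm_nonneg [simp]: "0 \<le> local_norm L x j"
  by (simp add: local_norm_def)

lemma local_norm_le: 
  assumes "0 < L" "j \<in> carrier G"
  shows "local_norm L x j \<le> coef_norm x"
proof -
  have "local_norm L x j \<le> L2_set (\<lambda>l. cmod (ip x (f l))) (near L j)"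
    unfolding local_norm_def
    using assms index_in_carrier
    by (intro L2_set_mono mult_left_le_one_le) (auto simp: window_def near_def intro!: tent_le_one)
  also have "\<dots> \<le> coef_norm x"
    by (rule L2_set_le_coef_norm[OF finite_near[OF assms(2)] near_subset])
  finally show ?thesis .
qed

lemma coefficient_le_local_norm:
  assumes "0 < L" "i \<in> I"
  shows "cmod (ip x (f i)) \<le> local_norm L x (a i)"
proof -
  have ai: "a i \<in> carrier G" using assms index_in_carrier by auto
  then have "i \<in> near L (a i)" "window L (a i) i = 1"
    using assms by (auto simp: near_def window_def len_one tent_one)
  then show ?thesis
    using member_le_L2_set[OF finite_near[OF ai], of i L "\<lambda>l. window L (a i) l * cmod (ip x (f l))"]
    by (simp add: local_norm_def)
qed

section \<open>Commutators of windows with the Gram matrix\<close>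

text \<open>\<open>damped L (a m - a l)\<close> bounds the entry at \<open>(l, m)\<close> of a commutator with a window of radius
  \<open>L\<close>. Such an entry vanishes unless one of \<open>a l\<close> and \<open>a m\<close> is within \<open>L\<close> of the centre \<open>j\<close>. If also
  \<open>a m\<close> is within \<open>L\<close> of \<open>j'\<close>, then \<open>k = a m - a l\<close> and \<open>h = j - j'\<close> satisfy
  \<open>|k + h| \<le> 2 L\<close> in the first case and \<open>|h| \<le> 2 L\<close> in the second; these are the two
  indicators in \<open>spread\<close>.\<close>

definition damped :: "real \<Rightarrow> 'g \<Rightarrow> real" where
  "damped L k = min 1 (len k / L) * r k"

definition spread :: "real \<Rightarrow> 'g \<Rightarrow> 'g \<Rightarrow> real" where
  "spread L h k = damped L k * (of_bool (len (k \<otimes> h) \<le> 2 * L) + of_bool (len h \<le> 2 * L))"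

definition window_kernel :: "real \<Rightarrow> 'g \<Rightarrow> real" where
  "window_kernel L h = \<mu> / tent_mass L * (\<Sum>\<^sub>\<infinity>k\<in>carrier G. spread L h k)"

lemma damped_nonneg: "0 < L \<Longrightarrow> k \<in> carrier G \<Longrightarrow> 0 \<le> damped L k"
  by (simp add: damped_def len_nonneg r_nonneg)

lemma damped_le: "0 < L \<Longrightarrow> k \<in> carrier G \<Longrightarrow> damped L k \<le> r k"
  unfolding damped_def by (rule mult_left_le_one_le) (simp_all add: len_nonneg r_nonneg)

lemma damped_summable: "0 < L \<Longrightarrow> damped L summable_on carrier G"
  by (rule summable_on_le[OF r_summable]) (simp_all add: damped_nonneg damped_le)

lemma spread_nonneg: "0 < L \<Longrightarrow> k \<in> carrier G \<Longrightarrow> 0 \<le> spread L h k"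
  by (simp add: spread_def damped_nonneg)

lemma spread_summable: "0 < L \<Longrightarrow> spread L h summable_on carrier G"
proof (rule summable_on_le[OF summable_on_cmult_left[OF damped_summable, of L 2]])
  assume "0 < L"
  fix k assume "k \<in> carrier G"
  then show "spread L h k \<le> damped L k * 2"
    unfolding spread_def using \<open>0 < L\<close> by (intro mult_left_mono damped_nonneg) auto
qed (simp_all add: spread_nonneg)

lemma window_kernel_nonneg: "2 \<le> L \<Longrightarrow> 0 \<le> window_kernel L h"
  unfolding window_kernel_def using ball_card_le_tent_mass(2)[of L]
  by (intro mult_nonneg_nonneg infsum_nonneg) (auto simp: \<mu>_nonneg spread_nonneg)

text \<open>For fixed \<open>k\<close> each indicator in \<open>spread\<close> holds for at most as many \<open>h\<close> as the ball of
  radius \<open>2 L\<close> has elements, a number that the normalisation by \<open>tent_mass\<close> compensates.\<close>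

lemma sum_window_kernel_le:
  assumes L: "2 \<le> L" and H: "finite H" "H \<subseteq> carrier G"
  shows "sum (window_kernel L) H \<le> 4 * \<mu> * D * infsum (damped L) (carrier G)"
proof -
  have L0: "0 < L" using L by simp
  note mass = ball_card_le_tent_mass[OF L]
  let ?B = "{x \<in> carrier G. len x \<le> 2 * L}"
  let ?W = "infsum (damped L) (carrier G)"
  have W0: "0 \<le> ?W" by (intro infsum_nonneg damped_nonneg L0)
  have "(\<Sum>h\<in>H. infsum (spread L h) (carrier G)) = (\<Sum>\<^sub>\<infinity>k\<in>carrier G. \<Sum>h\<in>H. spread L h k)"
    by (rule infsum_sum[symmetric]) (simp_all add: H spread_summable L0)
  also have "\<dots> \<le> (\<Sum>\<^sub>\<infinity>k\<in>carrier G. damped L k * (2 * real (card ?B)))"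
  proof (rule infsum_mono)
    show "(\<lambda>k. \<Sum>h\<in>H. spread L h k) summable_on carrier G"
      by (rule summable_on_sum) (simp_all add: H spread_summable L0)
    show "(\<lambda>k. damped L k * (2 * real (card ?B))) summable_on carrier G"
      by (rule summable_on_cmult_left[OF damped_summable[OF L0]])
    fix k assume k: "k \<in> carrier G"
    have inj: "inj_on ((\<otimes>) k) {h \<in> H. len (k \<otimes> h) \<le> 2 * L}"
      using bij_betw_imp_inj_on[OF bij_mult_left[OF k]] H(2) by (auto intro: inj_on_subset)
    have "(\<otimes>) k ` {h \<in> H. len (k \<otimes> h) \<le> 2 * L} \<subseteq> ?B"
      using k H(2) by auto
    from card_inj_on_le[OF inj this finite_ball]
    have 1: "card {h \<in> H. len (k \<otimes> h) \<le> 2 * L} \<le> card ?B" .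
    have 2: "card {h \<in> H. len h \<le> 2 * L} \<le> card ?B"
      using H by (intro card_mono finite_ball) auto
    have "(\<Sum>h\<in>H. spread L h k) = damped L k *
        (real (card {h \<in> H. len (k \<otimes> h) \<le> 2 * L}) + real (card {h \<in> H. len h \<le> 2 * L}))"
      unfolding spread_def sum_distrib_left[symmetric] sum.distrib
      by (simp add: sum_of_bool_eq H Int_def)
    also have "\<dots> \<le> damped L k * (2 * real (card ?B))"
      using 1 2 by (intro mult_left_mono damped_nonneg L0 k) linarith
    finally show "(\<Sum>h\<in>H. spread L h k) \<le> damped L k * (2 * real (card ?B))" .
  qed
  also have "\<dots> = ?W * (2 * real (card ?B))"
    by (rule infsum_cmult_left) (rule damped_summable[OF L0])
  also have "\<dots> \<le> ?W * (2 * (2 * D * tent_mass L))"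
    using mass(1) W0 by (intro mult_left_mono) auto
  finally have "\<mu> / tent_mass L * (\<Sum>h\<in>H. infsum (spread L h) (carrier G))
      \<le> \<mu> / tent_mass L * (?W * (2 * (2 * D * tent_mass L)))"
    using \<mu>_nonneg mass(2) by (intro mult_left_mono) auto
  also have "\<dots> = 4 * \<mu> * D * ?W"
    using mass(2) by (simp add: field_simps)
  finally show ?thesis by (simp add: window_kernel_def sum_distrib_left)
qed

text \<open>Dominated convergence: outside a finite set \<open>r\<close> has small mass, and on that set \<open>len k / L\<close>
  tends to \<open>0\<close>.\<close>

lemma damped_small:
  assumes "0 < \<epsilon>"
  obtains L where "2 \<le> L" "infsum (damped L) (carrier G) \<le> \<epsilon>"
proof -
  let ?R = "infsum r (carrier G)"
  obtain F where F: "finite F" "F \<subseteq> carrier G" "dist (sum r F) ?R \<le> \<epsilon> / 2"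
    using infsum_finite_approximation[OF r_summable, of "\<epsilon> / 2"] assms by auto
  have R0: "0 \<le> ?R" by (intro infsum_nonneg r_nonneg)
  define M where "M = (\<Sum>k\<in>F. len k)"
  have M: "len k \<le> M" if "k \<in> F" for k
    unfolding M_def using F that len_nonneg by (intro member_le_sum) auto
  define L where "L = max 2 (2 * M * ?R / \<epsilon>)"
  have L: "2 \<le> L" "0 < L" "2 * M * ?R / \<epsilon> \<le> L" by (auto simp: L_def)
  have "infsum (damped L) (carrier G) \<le> \<epsilon>"
  proof (rule infsum_le_finite_sums[OF damped_summable[OF L(2)]])
    fix H assume H: "finite H" "H \<subseteq> carrier G"
    have "sum (damped L) H \<le> sum (damped L) (F \<union> (H - F))"
      using F H L by (intro sum_mono2) (auto intro!: damped_nonneg)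
    also have "\<dots> = sum (damped L) F + sum (damped L) (H - F)"
      using F H by (intro sum.union_disjoint) auto
    also have "sum (damped L) F \<le> (\<Sum>k\<in>F. M / L * r k)"
    proof (rule sum_mono)
      fix k assume k: "k \<in> F"
      then have "min 1 (len k / L) \<le> M / L"
        using M[OF k] L(2) by (simp add: min_le_iff_disj divide_right_mono)
      then show "damped L k \<le> M / L * r k"
        unfolding damped_def using k F(2) by (intro mult_right_mono r_nonneg) auto
    qed
    also have "\<dots> = M / L * sum r F" by (simp add: sum_distrib_left)
    also have "\<dots> \<le> M / L * ?R"
      using F L by (intro mult_left_mono finite_sum_le_infsum r_summable)
        (auto intro!: r_nonneg sum_nonneg len_nonneg divide_nonneg_pos simp: M_def)
    also have "\<dots> \<le> \<epsilon> / 2"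
      using L assms by (simp add: field_simps)
    also have "sum (damped L) (H - F) \<le> sum r (H - F)"
      using H L by (intro sum_mono damped_le) auto
    also have "\<dots> \<le> \<epsilon> / 2"
    proof -
      have "sum r F + sum r (H - F) = sum r (F \<union> (H - F))"
        using F H by (intro sum.union_disjoint[symmetric]) auto
      also have "\<dots> \<le> ?R"
        using F H by (intro finite_sum_le_infsum r_summable) (auto intro!: r_nonneg)
      finally show ?thesis using F(3) unfolding dist_real_def by linarith
    qed
    finally show "sum (damped L) H \<le> \<epsilon>" by simp
  qed
  then show ?thesis using that L(1) by blast
qed

lemma window_kernel_summable: "2 \<le> L \<Longrightarrow> window_kernel L summable_on carrier G"
  by (rule nonneg_summable_onI[where c = "4 * \<mu> * D * infsum (damped L) (carrier G)"])
    (simp_all add: window_kernel_nonneg sum_window_kernel_le)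

lemma convolution_summable:
  assumes "2 \<le> L" "j \<in> carrier G"
  shows "(\<lambda>h. window_kernel L h * local_norm L x (gdiff j h)) summable_on carrier G"
  by (rule summable_on_le[OF summable_on_cmult_left[OF window_kernel_summable[OF assms(1)], of "coef_norm x"]])
    (use assms in \<open>auto intro!: mult_left_mono local_norm_le mult_nonneg_nonneg window_kernel_nonneg\<close>)

lemma window_diff_le:
  assumes L: "0 < L" and "j \<in> carrier G" "j' \<in> carrier G" "l \<in> I" "m \<in> I" "window L j' m \<noteq> 0"
  shows "\<bar>window L j l - window L j m\<bar> * r (gdiff (a m) (a l)) \<le> spread L (gdiff j j') (gdiff (a m) (a l))"
proof (cases "window L j l = 0 \<and> window L j m = 0")
  case True
  then show ?thesis using assms index_in_carrier by (simp add: spread_nonneg)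
next
  case False
  have am: "a m \<in> carrier G" and al: "a l \<in> carrier G" using assms index_in_carrier by auto
  have small: "len (gdiff (a i) k) \<le> L" if "window L k i \<noteq> 0" for i k
    using that tent_eq_0[OF L, of "gdiff (a i) k"] by (force simp: window_def)
  have j': "len (gdiff (a m) j') \<le> L" using assms small by auto
  have "len (gdiff (a m) (a l) \<otimes> gdiff j j') \<le> 2 * L \<or> len (gdiff j j') \<le> 2 * L"
  proof (cases "window L j l = 0")
    case False
    have "gdiff (a m) (a l) \<otimes> gdiff j j' = gdiff (gdiff (a m) j') (gdiff (a l) j)"
      using am al assms by (intro gdiff_mult_gdiff) auto
    then show ?thesis
      using len_gdiff_le[of "gdiff (a m) j'" "gdiff (a l) j"] small[OF False] j' am al assms by simp
  next
    case True
    then have "len (gdiff (a m) j) \<le> L" using False small by auto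
    moreover have "gdiff j j' = gdiff (gdiff (a m) j') (gdiff (a m) j)"
      using am assms by (intro gdiff_gdiff_left[symmetric]) auto
    ultimately show ?thesis
      using len_gdiff_le[of "gdiff (a m) j'" "gdiff (a m) j"] j' am assms by simp
  qed
  then have one: "1 \<le> (of_bool (len (gdiff (a m) (a l) \<otimes> gdiff j j') \<le> 2 * L) + of_bool (len (gdiff j j') \<le> 2 * L) :: real)"
    by auto
  have "\<bar>window L j l - window L j m\<bar> \<le> min 1 (len (gdiff (gdiff (a m) j) (gdiff (a l) j)) / L)"
    using tent_lipschitz[OF L, of "gdiff (a m) j" "gdiff (a l) j"] am al assms
    by (simp add: window_def abs_minus_commute)
  then have "\<bar>window L j l - window L j m\<bar> \<le> min 1 (len (gdiff (a m) (a l)) / L)"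
    using am al assms by (simp add: gdiff_gdiff_right)
  then have "\<bar>window L j l - window L j m\<bar> * r (gdiff (a m) (a l)) \<le> damped L (gdiff (a m) (a l))"
    unfolding damped_def using am al by (intro mult_right_mono r_nonneg) auto
  also have "\<dots> \<le> spread L (gdiff j j') (gdiff (a m) (a l))"
    unfolding spread_def using mult_left_mono[OF one damped_nonneg[OF L, of "gdiff (a m) (a l)"]] am al by simp
  finally show ?thesis .
qed

text \<open>Schur's test alone bounds the commutator by the global coefficient norm. The coefficients are
  therefore first split into windows, which sum to the constant \<open>tent_mass L\<close>; the commutator with
  the window at \<open>j\<close> sees the piece in the window at \<open>j'\<close> through a matrix whose rows and columns
  sum to at most the kernel at \<open>j - j'\<close>.\<close>

lemma finite_commutator_bound:
  assumes L: "2 \<le> L" and j: "j \<in> carrier G" and F: "finite F" "F \<subseteq> I" and F': "finite F'" "F' \<subseteq> I"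
  shows "L2_set (\<lambda>l. cmod (\<Sum>m\<in>F'. of_real (window L j l - window L j m) * ip x (f m) * ip (f m) (f l))) F
    \<le> (\<Sum>\<^sub>\<infinity>h\<in>carrier G. window_kernel L h * local_norm L x (gdiff j h))"
proof -
  have L0: "0 < L" using L by simp
  define V where "V = tent_mass L"
  have V: "0 < V" unfolding V_def by (rule ball_card_le_tent_mass[OF L])
  define c where "c m = cmod (ip x (f m))" for m
  define J where "J = (\<Union>m\<in>F'. {j' \<in> carrier G. len (gdiff (a m) j') \<le> L})"
  have aF: "a l \<in> carrier G" if "l \<in> F" for l using that F index_in_carrier by blast
  have aF': "a m \<in> carrier G" if "m \<in> F'" for m using that F' index_in_carrier by blast
  have J: "finite J" "J \<subseteq> carrier G"
    using F' index_in_carrier by (auto simp: J_def intro!: finite_translated_ball bij_gdiff_left)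
  have partition: "(\<Sum>j'\<in>J. window L j' m) = V" if "m \<in> F'" for m
    unfolding window_def V_def using J F' index_in_carrier that
    by (intro tent_sum_eq[OF L0 bij_gdiff_left]) (auto simp: J_def)
  define k where "k j' l m = (if window L j' m = 0 then 0 else
      \<bar>window L j l - window L j m\<bar> * r (gdiff (a m) (a l)) / V)" for j' l m
  have k0: "0 \<le> k j' l m" if "l \<in> F" "m \<in> F'" for j' l m
    using aF[OF that(1)] aF'[OF that(2)] V
    by (auto simp: k_def intro!: mult_nonneg_nonneg divide_nonneg_pos r_nonneg)
  have k_le: "k j' l m \<le> spread L (gdiff j j') (gdiff (a m) (a l)) / V" if "j' \<in> J" "l \<in> F" "m \<in> F'" for j' l m
  proof (cases "window L j' m = 0")
    case True
    then show ?thesis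
      using aF[OF that(2)] aF'[OF that(3)] V by (auto simp: k_def intro!: divide_nonneg_pos spread_nonneg L0)
  next
    case False
    then show ?thesis
      unfolding k_def using that(1) F(2) F'(2) J(2) V
      by (auto intro!: divide_right_mono window_diff_le[OF L0 j] subsetD[OF F(2) that(2)] subsetD[OF F'(2) that(3)])
  qed
  have "L2_set (\<lambda>l. cmod (\<Sum>m\<in>F'. of_real (window L j l - window L j m) * ip x (f m) * ip (f m) (f l))) F
      \<le> L2_set (\<lambda>l. \<Sum>j'\<in>J. \<Sum>m\<in>F'. k j' l m * (window L j' m * c m)) F"
  proof (rule L2_set_mono)
    fix l assume l: "l \<in> F"
    have "cmod (\<Sum>m\<in>F'. of_real (window L j l - window L j m) * ip x (f m) * ip (f m) (f l))
        \<le> (\<Sum>m\<in>F'. \<bar>window L j l - window L j m\<bar> * r (gdiff (a m) (a l)) * c m)"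
    proof (rule sum_norm_le)
      fix m assume m: "m \<in> F'"
      have "cmod (of_real (window L j l - window L j m) * ip x (f m) * ip (f m) (f l))
          = \<bar>window L j l - window L j m\<bar> * c m * cmod (ip (f m) (f l))"
        by (simp only: norm_mult norm_of_real c_def)
      also have "\<dots> \<le> \<bar>window L j l - window L j m\<bar> * c m * r (gdiff (a m) (a l))"
        using l m F F' by (intro mult_left_mono gram_le) (auto simp: c_def)
      finally show "cmod (of_real (window L j l - window L j m) * ip x (f m) * ip (f m) (f l))
          \<le> \<bar>window L j l - window L j m\<bar> * r (gdiff (a m) (a l)) * c m"
        by (simp only: mult_ac)
    qed
    also have "\<dots> = (\<Sum>m\<in>F'. \<Sum>j'\<in>J. k j' l m * (window L j' m * c m))"
    proof (rule sum.cong[OF refl])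
      fix m assume m: "m \<in> F'"
      let ?q = "\<bar>window L j l - window L j m\<bar> * r (gdiff (a m) (a l))"
      have "(\<Sum>j'\<in>J. k j' l m * (window L j' m * c m)) = (\<Sum>j'\<in>J. ?q / V * c m * window L j' m)"
        by (rule sum.cong) (auto simp: k_def)
      also have "\<dots> = ?q / V * c m * V"
        by (simp only: sum_distrib_left[symmetric] partition[OF m])
      finally show "?q * c m = (\<Sum>j'\<in>J. k j' l m * (window L j' m * c m))"
        using V by simp
    qed
    also have "\<dots> = (\<Sum>j'\<in>J. \<Sum>m\<in>F'. k j' l m * (window L j' m * c m))"
      by (rule sum.swap)
    finally show "cmod (\<Sum>m\<in>F'. of_real (window L j l - window L j m) * ip x (f m) * ip (f m) (f l))
        \<le> (\<Sum>j'\<in>J. \<Sum>m\<in>F'. k j' l m * (window L j' m * c m))" .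
  qed simp
  also have "\<dots> \<le> (\<Sum>j'\<in>J. L2_set (\<lambda>l. \<Sum>m\<in>F'. k j' l m * (window L j' m * c m)) F)"
    by (rule L2_set_sum_le)
  also have "\<dots> \<le> (\<Sum>j'\<in>J. window_kernel L (gdiff j j') * local_norm L x j')"
  proof (rule sum_mono)
    fix j' assume j': "j' \<in> J"
    then have j'': "j' \<in> carrier G" using J by auto
    let ?s = "spread L (gdiff j j')"
    have s: "?s summable_on carrier G" "\<And>g. g \<in> carrier G \<Longrightarrow> 0 \<le> ?s g"
      by (simp_all add: spread_summable spread_nonneg L0)
    have V_kernel: "(\<mu> * infsum ?s (carrier G)) / V = window_kernel L (gdiff j j')"
      by (simp add: window_kernel_def V_def)
    have "L2_set (\<lambda>l. \<Sum>m\<in>F'. k j' l m * (window L j' m * c m)) F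
        \<le> window_kernel L (gdiff j j') * L2_set (\<lambda>m. window L j' m * c m) F'"
    proof (rule schur_test)
      fix l assume l: "l \<in> F"
      have "(\<Sum>m\<in>F'. k j' l m) \<le> (\<Sum>m\<in>F'. ?s (gdiff (a m) (a l)) / V)"
        by (intro sum_mono k_le j' l)
      also have "\<dots> = (\<Sum>m\<in>F'. ?s (gdiff (a m) (a l))) / V" by (simp add: sum_divide_distrib)
      also have "\<dots> \<le> (\<mu> * infsum ?s (carrier G)) / V"
        using l F F' index_in_carrier V
        by (intro divide_right_mono sum_over_indices_le[where b = "\<lambda>g. gdiff g (a l)"] s bij_gdiff_right) auto
      finally show "(\<Sum>m\<in>F'. k j' l m) \<le> window_kernel L (gdiff j j')" by (simp only: V_kernel)
    next
      fix m assume m: "m \<in> F'"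
      have "(\<Sum>l\<in>F. k j' l m) \<le> (\<Sum>l\<in>F. ?s (gdiff (a m) (a l)) / V)"
        by (intro sum_mono k_le j' m)
      also have "\<dots> = (\<Sum>l\<in>F. ?s (gdiff (a m) (a l))) / V" by (simp add: sum_divide_distrib)
      also have "\<dots> \<le> (\<mu> * infsum ?s (carrier G)) / V"
        using m F F' index_in_carrier V
        by (intro divide_right_mono sum_over_indices_le[where b = "\<lambda>g. gdiff (a m) g"] s bij_gdiff_left) auto
      finally show "(\<Sum>l\<in>F. k j' l m) \<le> window_kernel L (gdiff j j')" by (simp only: V_kernel)
    qed (use k0 window_kernel_nonneg[OF L] in auto)
    also have "\<dots> \<le> window_kernel L (gdiff j j') * local_norm L x j'"
      unfolding local_norm_def c_def
      using F' L0 finite_near[OF j''] window_eq_0 window_kernel_nonneg[OF L]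
      by (intro mult_left_mono L2_set_mono_neutral) auto
    finally show "L2_set (\<lambda>l. \<Sum>m\<in>F'. k j' l m * (window L j' m * c m)) F
        \<le> window_kernel L (gdiff j j') * local_norm L x j'" .
  qed
  also have "\<dots> = (\<Sum>j'\<in>J. window_kernel L (gdiff j j') * local_norm L x (gdiff j (gdiff j j')))"
    using J j by (intro sum.cong) (auto simp: gdiff_gdiff_self)
  also have "\<dots> \<le> (\<Sum>\<^sub>\<infinity>h\<in>carrier G. window_kernel L h * local_norm L x (gdiff j h))"
    by (rule sum_translate_le_infsum[where b = "\<lambda>h. gdiff j h", OF convolution_summable[OF L j]])
      (use J j L in \<open>auto intro!: mult_nonneg_nonneg window_kernel_nonneg bij_gdiff_left\<close>)
  finally show ?thesis .
qed

lemma commutator_bound: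
  assumes L: "2 \<le> L" and j: "j \<in> carrier G" and F: "finite F" "F \<subseteq> I"
  shows "L2_set (\<lambda>l. cmod (commutator (window L j) (near L j) x l)) F
    \<le> (\<Sum>\<^sub>\<infinity>h\<in>carrier G. window_kernel L h * local_norm L x (gdiff j h))"
proof -
  let ?p = "\<lambda>F' l. \<Sum>m\<in>F'. of_real (window L j l - window L j m) * ip x (f m) * ip (f m) (f l)"
  have "((\<lambda>F'. ?p F' l) \<longlongrightarrow> commutator (window L j) (near L j) x l) (finite_subsets_at_top I)" for l
    using commutator_has_sum[OF finite_near[OF j] near_subset, where \<phi> = "window L j" and x = x and l = l]
      window_eq_0[of L] L unfolding has_sum_def by simp
  then have "((\<lambda>F'. L2_set (\<lambda>l. cmod (?p F' l)) F) \<longlongrightarrow>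
      L2_set (\<lambda>l. cmod (commutator (window L j) (near L j) x l)) F) (finite_subsets_at_top I)"
    unfolding L2_set_def by (intro tendsto_intros)
  then show ?thesis
    by (rule tendsto_upperbound, intro eventually_finite_subsets_at_top_weakI finite_commutator_bound assms)
      simp_all
qed

section \<open>Localization of the inverse powers of the frame operator\<close>

definition inverse_orbit :: "nat \<Rightarrow> 'i \<Rightarrow> 'h" where
  "inverse_orbit k i = (op_inv S ^^ Suc k) (f i)"

lemma frame_operator_inverse_orbit:
  "S (inverse_orbit 0 i) = f i" "S (inverse_orbit (Suc k) i) = inverse_orbit k i"
  by (simp_all add: inverse_orbit_def)

lemma norm_frame_vector_le: "i \<in> I \<Longrightarrow> norm (f i) \<le> sqrt B"
proof -
  assume i: "i \<in> I"
  have "norm (f i) * norm (f i) = cmod (ip (f i) (f i))"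
    by (simp only: ip_self norm_of_real abs_power2) (simp only: power2_eq_square)
  also have "\<dots> \<le> sqrt B * norm (f i)"
    using L2_set_coefficients_le[of "{i}" "f i"] i by simp
  finally show ?thesis
    by (rule le_if_square_le_mult) (use B_pos in simp)
qed

lemma norm_inverse_orbit_le: "i \<in> I \<Longrightarrow> norm (inverse_orbit k i) \<le> sqrt B / A ^ Suc k"
proof (induction k)
  case 0
  have "norm (inverse_orbit 0 i) \<le> norm (f i) / A"
    using norm_inverse_le[of "f i"] by (simp add: inverse_orbit_def)
  also have "\<dots> \<le> sqrt B / A"
    using norm_frame_vector_le[OF 0] A_pos by (simp add: divide_right_mono)
  finally show ?case by simp
next
  case (Suc k)
  have "norm (inverse_orbit (Suc k) i) \<le> norm (inverse_orbit k i) / A"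
    using norm_inverse_le[of "inverse_orbit k i"] by (simp add: inverse_orbit_def)
  also have "\<dots> \<le> sqrt B / A ^ Suc k / A"
    by (rule divide_right_mono) (use Suc A_pos in simp_all)
  finally show ?case by (simp add: field_simps)
qed

lemma scaled_local_norm_le:
  assumes "0 < L" "i \<in> I" "j \<in> carrier G"
  shows "(A / 4) ^ k * local_norm L (inverse_orbit k i) j \<le> B / A"
proof -
  have "local_norm L (inverse_orbit k i) j \<le> sqrt B * norm (inverse_orbit k i)"
    using local_norm_le[OF assms(1,3)] coef_norm_upper by (rule order_trans)
  also have "\<dots> \<le> sqrt B * (sqrt B / A ^ Suc k)"
    using B_pos by (intro mult_left_mono norm_inverse_orbit_le assms) auto
  also have "\<dots> = B / A ^ Suc k" using B_pos by simp
  finally have "(A / 4) ^ k * local_norm L (inverse_orbit k i) j \<le> (A / 4) ^ k * (B / A ^ Suc k)"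
    using A_pos by (intro mult_left_mono) auto
  also have "\<dots> = (1 / 4) ^ k * (B / A)"
    using A_pos by (simp add: power_divide field_simps)
  also have "\<dots> \<le> 1 * (B / A)"
    using A_pos B_pos by (intro mult_right_mono power_le_one) auto
  finally show ?thesis by simp
qed

text \<open>A bound for the local norms of the coefficients of \<open>f\<^sub>i\<close>, at distance \<open>g\<close> from \<open>a i\<close>, obtained
  from the localization of the Gram matrix; \<open>f\<^sub>i\<close> plays the part of the power \<open>S\<^sup>0 f\<^sub>i\<close> that starts the
  recursion over \<open>k\<close>.\<close>

definition gram_tail :: "real \<Rightarrow> 'g \<Rightarrow> real" where
  "gram_tail L g = \<mu> * (\<Sum>\<^sub>\<infinity>k\<in>carrier G. tent L (k \<otimes> g) * r k)"

lemma tent_gram_summable: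
  assumes "0 < L" "g \<in> carrier G"
  shows "(\<lambda>k. tent L (k \<otimes> g) * r k) summable_on carrier G"
  by (rule summable_on_le[OF r_summable])
    (use assms in \<open>auto intro!: mult_left_le_one_le mult_nonneg_nonneg r_nonneg tent_le_one\<close>)

lemma gram_tail_nonneg: "g \<in> carrier G \<Longrightarrow> 0 \<le> gram_tail L g"
  unfolding gram_tail_def by (intro mult_nonneg_nonneg infsum_nonneg \<mu>_nonneg r_nonneg) auto

lemma local_norm_frame_vector_le:
  assumes "0 < L" "i \<in> I" "g \<in> carrier G"
  shows "local_norm L (f i) (a i \<otimes> g) \<le> gram_tail L g"
proof -
  have ai: "a i \<in> carrier G" using assms index_in_carrier by auto
  let ?j = "a i \<otimes> g"
  have j: "?j \<in> carrier G" using ai assms by auto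
  have "local_norm L (f i) ?j \<le> (\<Sum>l\<in>near L ?j. window L ?j l * cmod (ip (f i) (f l)))"
    unfolding local_norm_def by (rule L2_set_le_sum) simp
  also have "\<dots> \<le> (\<Sum>l\<in>near L ?j. tent L (gdiff (a i) (a l) \<otimes> g) * r (gdiff (a i) (a l)))"
  proof (rule sum_mono)
    fix l assume "l \<in> near L ?j"
    then have l: "l \<in> I" "a l \<in> carrier G" using near_subset index_in_carrier by auto
    have "gdiff ?j (a l) = gdiff (a i) (a l) \<otimes> g"
      using ai l assms by (simp add: m_ac)
    then have "window L ?j l = tent L (gdiff (a i) (a l) \<otimes> g)"
      unfolding window_def using tent_gdiff_commute[OF l(2) j] by simp
    then show "window L ?j l * cmod (ip (f i) (f l)) \<le> tent L (gdiff (a i) (a l) \<otimes> g) * r (gdiff (a i) (a l))"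
      using gram_le[OF assms(2) l(1)] by (simp add: mult_left_mono)
  qed
  also have "\<dots> \<le> gram_tail L g"
    unfolding gram_tail_def
    by (rule sum_over_indices_le[where b = "\<lambda>h. gdiff (a i) h" and q = "\<lambda>k. tent L (k \<otimes> g) * r k"])
      (use assms ai j near_subset in \<open>auto intro!: tent_gram_summable mult_nonneg_nonneg r_nonneg bij_gdiff_left finite_near\<close>)
  finally show ?thesis .
qed

lemma sum_gram_tail_le:
  assumes L: "0 < L" and F: "finite F" "F \<subseteq> carrier G"
  shows "sum (gram_tail L) F \<le> \<mu> * (tent_mass L * infsum r (carrier G))"
proof -
  have sm: "(\<lambda>k. tent L (k \<otimes> g) * r k) summable_on carrier G" if "g \<in> F" for g
    using tent_gram_summable[OF L] that F by blast
  have "(\<Sum>g\<in>F. \<Sum>\<^sub>\<infinity>k\<in>carrier G. tent L (k \<otimes> g) * r k) = (\<Sum>\<^sub>\<infinity>k\<in>carrier G. \<Sum>g\<in>F. tent L (k \<otimes> g) * r k)"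
    by (rule infsum_sum[symmetric, OF F(1) sm])
  also have "\<dots> \<le> (\<Sum>\<^sub>\<infinity>k\<in>carrier G. tent_mass L * r k)"
  proof (rule infsum_mono)
    show "(\<lambda>k. \<Sum>g\<in>F. tent L (k \<otimes> g) * r k) summable_on carrier G"
      by (rule summable_on_sum[OF F(1) sm])
    show "(\<lambda>k. tent_mass L * r k) summable_on carrier G"
      by (rule summable_on_cmult_right[OF r_summable])
    fix k assume k: "k \<in> carrier G"
    have "(\<Sum>g\<in>F. tent L (k \<otimes> g)) \<le> tent_mass L"
      by (rule tent_sum_le[OF L bij_mult_left[OF k] F])
    then show "(\<Sum>g\<in>F. tent L (k \<otimes> g) * r k) \<le> tent_mass L * r k"
      using r_nonneg[OF k] by (simp add: sum_distrib_right[symmetric] mult_right_mono)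
  qed
  also have "\<dots> = tent_mass L * infsum r (carrier G)"
    by (rule infsum_cmult_right) (rule r_summable)
  finally show ?thesis
    unfolding gram_tail_def sum_distrib_left[symmetric] by (intro mult_left_mono \<mu>_nonneg)
qed

text \<open>The lower bound for truncated sequences at \<open>S\<^sup>-\<^sup>k\<^sup>-\<^sup>1 f\<^sub>i\<close> involves the neighbouring powers: one
  power less, with constant \<open>1 / A\<close>, and one power more, with the small kernel. Neither can be
  estimated by the other, so all powers are treated at once: with weights \<open>\<rho>\<^sup>k\<close>, \<open>\<rho> = A / 4\<close>, the
  first contribution becomes \<open>\<rho> / A = 1 / 4\<close> of the supremum over \<open>k\<close> and can be absorbed, while
  the second is multiplied by \<open>2 / \<rho>\<close>, which is harmless because the kernel can be made
  arbitrarily small. The supremum is finite since \<open>\<parallel>S\<^sup>-\<^sup>1\<parallel> \<le> 1 / A\<close>.\<close>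

theorem inverse_powers_localized:
  obtains t where "t summable_on carrier G" "\<And>g. g \<in> carrier G \<Longrightarrow> 0 \<le> t g"
    "\<And>k i j. i \<in> I \<Longrightarrow> j \<in> I \<Longrightarrow> cmod (ip (inverse_orbit k j) (f i)) \<le> (4 / A) ^ k * t (gdiff (a i) (a j))"
proof (cases "I = {}")
  case True
  then show ?thesis using that[of "\<lambda>_. 0"] by simp
next
  case False
  define \<rho> where "\<rho> = A / 4"
  have \<rho>: "0 < \<rho>" using A_pos by (simp add: \<rho>_def)
  have D: "0 \<le> D" by (rule ball_card_le_tent_mass(3)[of 2]) simp
  \<comment> \<open>The constant makes the mass of \<open>s\<close> below at most \<open>1 / 2\<close>; the summand \<open>1\<close> guards against
    \<open>\<mu> D = 0\<close>.\<close>
  have "0 < A / (96 * (\<mu> * D + 1))"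
    using A_pos \<mu>_nonneg D by (intro divide_pos_pos) (auto intro!: add_nonneg_pos mult_nonneg_nonneg)
  then obtain L where L: "2 \<le> L" and small: "infsum (damped L) (carrier G) \<le> A / (96 * (\<mu> * D + 1))"
    by (rule damped_small)
  have L0: "0 < L" using L by simp
  \<comment> \<open>Below, \<open>t \<le> y / A + t / 4 + 9 / A * C\<close> is solved for \<open>t\<close>, which multiplies \<open>9 / A\<close> by
    \<open>4 / 3\<close>.\<close>
  define s where "s h = 12 / A * window_kernel L h" for h
  have s0: "0 \<le> s h" for h
    using A_pos window_kernel_nonneg[OF L] by (simp add: s_def)
  have s_sum: "sum s F \<le> 1 / 2" if F: "finite F" "F \<subseteq> carrier G" for F
  proof -
    have "sum s F = 12 / A * sum (window_kernel L) F"
      by (simp add: s_def sum_distrib_left)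
    also have "\<dots> \<le> 12 / A * (4 * \<mu> * D * infsum (damped L) (carrier G))"
      using A_pos by (intro mult_left_mono sum_window_kernel_le L F) auto
    also have "\<dots> \<le> 12 / A * (4 * \<mu> * D * (A / (96 * (\<mu> * D + 1))))"
      using A_pos \<mu>_nonneg D small by (intro mult_left_mono) auto
    also have "\<dots> \<le> 1 / 2"
    proof -
      have "0 \<le> \<mu> * D" using \<mu>_nonneg D by simp
      then show ?thesis using A_pos by (simp add: field_simps)
    qed
    finally show ?thesis .
  qed
  define n where "n k i = local_norm L (inverse_orbit k i)" for k i
  define t where "t g = (SUP (k, i)\<in>UNIV \<times> I. \<rho> ^ k * n k i (a i \<otimes> g))" for g
  define C where "C g = (\<Sum>\<^sub>\<infinity>h\<in>carrier G. window_kernel L h * t (gdiff g h))" for g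
  have ag: "a i \<otimes> g \<in> carrier G" if "i \<in> I" "g \<in> carrier G" for i g
    using that index_in_carrier by auto
  have n_le: "\<rho> ^ k * n k i (a i \<otimes> g) \<le> B / A" if "i \<in> I" "g \<in> carrier G" for k i g
    unfolding \<rho>_def n_def by (rule scaled_local_norm_le[OF L0 that(1) ag[OF that]])
  have n_le_t: "\<rho> ^ k * n k i (a i \<otimes> g) \<le> t g" if i: "i \<in> I" and g: "g \<in> carrier G" for k i g
  proof -
    have bdd: "bdd_above ((\<lambda>(k, i). \<rho> ^ k * n k i (a i \<otimes> g)) ` (UNIV \<times> I))"
      by (rule bdd_aboveI2[where M = "B / A"]) (use n_le[OF _ g] in auto)
    show ?thesis
      unfolding t_def using cSUP_upper[OF _ bdd, of "(k, i)"] i by simp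
  qed
  have t_leI: "t g \<le> c" if "\<And>k i. i \<in> I \<Longrightarrow> \<rho> ^ k * n k i (a i \<otimes> g) \<le> c" for g c
    unfolding t_def using that False by (intro cSUP_least) auto
  have t_le: "t g \<le> B / A" if "g \<in> carrier G" for g
    by (rule t_leI) (rule n_le[OF _ that])
  have t0: "0 \<le> t g" if g: "g \<in> carrier G" for g
  proof -
    obtain i where i: "i \<in> I" using False by blast
    have "0 \<le> \<rho> ^ 0 * n 0 i (a i \<otimes> g)" by (simp add: n_def)
    then show ?thesis using n_le_t[OF i g, of 0] by linarith
  qed
  have conv_summable: "(\<lambda>h. window_kernel L h * t (gdiff g h)) summable_on carrier G" if "g \<in> carrier G" for g
  proof (rule summable_on_le[OF summable_on_cmult_left[OF window_kernel_summable[OF L], of "B / A"]])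
    fix h assume h: "h \<in> carrier G"
    show "0 \<le> window_kernel L h * t (gdiff g h)"
      using that h by (intro mult_nonneg_nonneg t0 window_kernel_nonneg L) auto
    show "window_kernel L h * t (gdiff g h) \<le> window_kernel L h * (B / A)"
      using that h by (intro mult_left_mono t_le window_kernel_nonneg L) auto
  qed
  have conv_le: "\<rho> ^ k * (\<Sum>\<^sub>\<infinity>h\<in>carrier G. window_kernel L h * n k i (gdiff (a i \<otimes> g) h)) \<le> C g"
    if i: "i \<in> I" and g: "g \<in> carrier G" for k i g
  proof -
    have sm: "(\<lambda>h. window_kernel L h * n k i (gdiff (a i \<otimes> g) h)) summable_on carrier G"
      unfolding n_def by (rule convolution_summable[OF L ag[OF i g]])
    have "\<rho> ^ k * (\<Sum>\<^sub>\<infinity>h\<in>carrier G. window_kernel L h * n k i (gdiff (a i \<otimes> g) h))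
        = (\<Sum>\<^sub>\<infinity>h\<in>carrier G. \<rho> ^ k * (window_kernel L h * n k i (gdiff (a i \<otimes> g) h)))"
      by (rule infsum_cmult_right[symmetric]) (rule sm)
    also have "\<dots> \<le> C g"
      unfolding C_def
    proof (rule infsum_mono)
      show "(\<lambda>h. \<rho> ^ k * (window_kernel L h * n k i (gdiff (a i \<otimes> g) h))) summable_on carrier G"
        by (rule summable_on_cmult_right[OF sm])
      show "(\<lambda>h. window_kernel L h * t (gdiff g h)) summable_on carrier G"
        by (rule conv_summable[OF g])
      fix h assume h: "h \<in> carrier G"
      have "gdiff (a i \<otimes> g) h = a i \<otimes> gdiff g h"
        using i g h index_in_carrier by (simp add: m_assoc)
      then have "\<rho> ^ k * n k i (gdiff (a i \<otimes> g) h) \<le> t (gdiff g h)"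
        using n_le_t[OF i, of "gdiff g h" k] g h by simp
      then have "window_kernel L h * (\<rho> ^ k * n k i (gdiff (a i \<otimes> g) h)) \<le> window_kernel L h * t (gdiff g h)"
        by (intro mult_left_mono window_kernel_nonneg L)
      then show "\<rho> ^ k * (window_kernel L h * n k i (gdiff (a i \<otimes> g) h)) \<le> window_kernel L h * t (gdiff g h)"
        by (simp only: mult.left_commute)
    qed
    finally show ?thesis .
  qed
  have key: "\<rho> ^ k * n k i (a i \<otimes> g) \<le> gram_tail L g / A + t g / 4 + 9 / A * C g"
    if i: "i \<in> I" and g: "g \<in> carrier G" for k i g
  proof -
    let ?j = "a i \<otimes> g"
    have j: "?j \<in> carrier G" by (rule ag[OF i g])
    define E where "E k = (\<Sum>\<^sub>\<infinity>h\<in>carrier G. window_kernel L h * n k i (gdiff ?j h))" for k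
    have "local_norm L (inverse_orbit k i) ?j
        \<le> (local_norm L (S (inverse_orbit k i)) ?j + E k) / A + 2 * E (Suc k)"
      unfolding local_norm_def
      by (rule truncated_lower_bound[where x' = "inverse_orbit (Suc k) i"])
        (simp_all add: finite_near[OF j] near_subset window_eq_0[OF L0] frame_operator_inverse_orbit E_def n_def
          commutator_bound[OF L j])
    then have "\<rho> ^ k * n k i ?j \<le> \<rho> ^ k * ((local_norm L (S (inverse_orbit k i)) ?j + E k) / A + 2 * E (Suc k))"
      unfolding n_def using \<rho> by (intro mult_left_mono) auto
    also have "\<dots> = (\<rho> ^ k * local_norm L (S (inverse_orbit k i)) ?j) / A + (\<rho> ^ k * E k) / A
        + 8 / A * (\<rho> ^ Suc k * E (Suc k))"
      using A_pos by (simp add: \<rho>_def field_simps)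
    also have "\<dots> \<le> (gram_tail L g + \<rho> * t g) / A + C g / A + 8 / A * C g"
    proof -
      have "\<rho> ^ k * local_norm L (S (inverse_orbit k i)) ?j \<le> gram_tail L g + \<rho> * t g"
      proof (cases k)
        case 0
        have "0 \<le> \<rho> * t g" using \<rho> t0[OF g] by simp
        then show ?thesis
          using local_norm_frame_vector_le[OF L0 i g] by (simp add: 0 frame_operator_inverse_orbit)
      next
        case (Suc k')
        have "\<rho> ^ k * local_norm L (S (inverse_orbit k i)) ?j = \<rho> * (\<rho> ^ k' * n k' i ?j)"
          by (simp add: Suc frame_operator_inverse_orbit n_def)
        also have "\<dots> \<le> \<rho> * t g"
          using \<rho> by (intro mult_left_mono n_le_t i g) auto
        finally show ?thesis using gram_tail_nonneg[OF g, of L] by linarith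
      qed
      moreover have "\<rho> ^ k * E k \<le> C g" "\<rho> ^ Suc k * E (Suc k) \<le> C g"
        unfolding E_def by (rule conv_le[OF i g])+
      ultimately show ?thesis
        using A_pos by (intro add_mono mult_left_mono divide_right_mono) auto
    qed
    also have "\<dots> = gram_tail L g / A + t g / 4 + 9 / A * C g"
      using A_pos by (simp add: \<rho>_def field_simps)
    finally show ?thesis .
  qed
  have "t summable_on carrier G"
  proof (rule summable_of_convolution_inequality[where T = "B / A"])
    fix g assume g: "g \<in> carrier G"
    have "t g \<le> gram_tail L g / A + t g / 4 + 9 / A * C g"
      by (rule t_leI) (rule key[OF _ g])
    then have "t g \<le> 4 / (3 * A) * gram_tail L g + 12 / A * C g"
      using A_pos by (simp add: field_simps)
    also have "12 / A * C g = (\<Sum>\<^sub>\<infinity>h\<in>carrier G. s h * t (gdiff g h))"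
      unfolding C_def s_def mult.assoc by (rule infsum_cmult_right[symmetric]) (rule conv_summable[OF g])
    finally show "t g \<le> 4 / (3 * A) * gram_tail L g + (\<Sum>\<^sub>\<infinity>h\<in>carrier G. s h * t (gdiff g h))" .
  next
    fix F assume "finite F" "F \<subseteq> carrier G"
    then show "(\<Sum>g\<in>F. 4 / (3 * A) * gram_tail L g) \<le> 4 / (3 * A) * (\<mu> * (tent_mass L * infsum r (carrier G)))"
      unfolding sum_distrib_left[symmetric] using A_pos by (intro mult_left_mono sum_gram_tail_le L0) auto
  qed (use s0 s_sum t0 t_le in auto)
  moreover have "cmod (ip (inverse_orbit k j) (f i)) \<le> (4 / A) ^ k * t (gdiff (a i) (a j))"
    if i: "i \<in> I" and j: "j \<in> I" for k i j
  proof -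
    have ai: "a i \<in> carrier G" and aj: "a j \<in> carrier G" using i j index_in_carrier by auto
    have "a j \<otimes> gdiff (a i) (a j) = a i"
      using ai aj by (simp add: m_lcomm)
    then have "\<rho> ^ k * n k j (a i) \<le> t (gdiff (a i) (a j))"
      using n_le_t[OF j, of "gdiff (a i) (a j)" k] ai aj by simp
    moreover have "cmod (ip (inverse_orbit k j) (f i)) \<le> n k j (a i)"
      unfolding n_def by (rule coefficient_le_local_norm[OF L0 i])
    ultimately have "\<rho> ^ k * cmod (ip (inverse_orbit k j) (f i)) \<le> t (gdiff (a i) (a j))"
      using \<rho> by (meson order_trans mult_left_mono zero_le_power less_imp_le)
    moreover have "(4 / A) ^ k * \<rho> ^ k = 1"
      using A_pos by (simp add: \<rho>_def power_mult_distrib[symmetric])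
    ultimately show ?thesis
      using A_pos mult_left_mono[of "\<rho> ^ k * cmod (ip (inverse_orbit k j) (f i))" _ "(4 / A) ^ k"]
      by (simp add: mult.assoc[symmetric])
  qed
  ultimately show ?thesis using that t0 by blast
qed

end

section \<open>The index group\<close>

lemma lattice_group_comm_group: "comm_group (lattice_group \<alpha>)"
proof (rule comm_groupI)
  fix x assume "x \<in> carrier (lattice_group \<alpha>)"
  then obtain k :: int where "x = \<alpha> * of_int k" by (auto simp: lattice_group_def)
  then show "\<exists>y\<in>carrier (lattice_group \<alpha>). y \<otimes>\<^bsub>lattice_group \<alpha>\<^esub> x = \<one>\<^bsub>lattice_group \<alpha>\<^esub>"
    by (intro bexI[of _ "- x"]) (auto simp: lattice_group_def intro!: range_eqI[of _ _ "- k"])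
qed (auto simp: lattice_group_def algebra_simps simp flip: of_int_add distrib_left intro: rangeI)

lemma inv_lattice_group: "x \<in> carrier (lattice_group \<alpha>) \<Longrightarrow> inv\<^bsub>lattice_group \<alpha>\<^esub> x = - x"
proof (rule group.inv_equality)
  show "group (lattice_group \<alpha>)" using lattice_group_comm_group comm_group_def by blast
  assume "x \<in> carrier (lattice_group \<alpha>)"
  then obtain k :: int where "x = \<alpha> * of_int k" by (auto simp: lattice_group_def)
  then show "- x \<in> carrier (lattice_group \<alpha>)"
    by (auto simp: lattice_group_def intro!: range_eqI[of _ _ "- k"])
qed (simp_all add: lattice_group_def)

lemma comm_group_product_group:
  assumes "\<And>i. i \<in> X \<Longrightarrow> comm_group (H i)"
  shows "comm_group (product_group X H)"
proof (rule group.group_comm_groupI)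
  show "group (product_group X H)"
    using assms by (intro product_group) (auto simp: comm_group_def)
  fix x y assume "x \<in> carrier (product_group X H)" "y \<in> carrier (product_group X H)"
  then show "x \<otimes>\<^bsub>product_group X H\<^esub> y = y \<otimes>\<^bsub>product_group X H\<^esub> x"
    using assms by (auto simp: restrict_def fun_eq_iff PiE_iff intro!: comm_monoid.m_comm comm_group.axioms(1))
qed

definition torsion_size :: "int \<Rightarrow> real" where
  "torsion_size m = (if m = 0 then 0 else 1)"

lemma lattice_ball:
  assumes "0 < \<alpha>"
  shows "{x \<in> carrier (lattice_group \<alpha>). \<bar>x\<bar> \<le> R} = (\<lambda>k::int. \<alpha> * of_int k) ` {- \<lfloor>R / \<alpha>\<rfloor>..\<lfloor>R / \<alpha>\<rfloor>}"
proof -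
  have "\<bar>\<alpha> * of_int k\<bar> \<le> R \<longleftrightarrow> k \<in> {- \<lfloor>R / \<alpha>\<rfloor>..\<lfloor>R / \<alpha>\<rfloor>}" for k :: int
  proof -
    have "\<bar>\<alpha> * of_int k\<bar> \<le> R \<longleftrightarrow> of_int \<bar>k\<bar> \<le> R / \<alpha>"
      using assms by (simp add: abs_mult field_simps)
    then show ?thesis by (simp add: le_floor_iff[symmetric] abs_le_iff del: of_int_abs) linarith
  qed
  then have "{k :: int. \<bar>\<alpha> * of_int k\<bar> \<le> R} = {- \<lfloor>R / \<alpha>\<rfloor>..\<lfloor>R / \<alpha>\<rfloor>}" by blast
  moreover have "{x \<in> carrier (lattice_group \<alpha>). \<bar>x\<bar> \<le> R} = (\<lambda>k::int. \<alpha> * of_int k) ` {k. \<bar>\<alpha> * of_int k\<bar> \<le> R}"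
    by (simp only: lattice_group_def partial_object.simps) blast
  ultimately show ?thesis by (simp only:)
qed

lemma card_lattice_ball:
  assumes "0 < \<alpha>"
  shows "card {x \<in> carrier (lattice_group \<alpha>). \<bar>x\<bar> \<le> R} = nat (2 * \<lfloor>R / \<alpha>\<rfloor> + 1)"
  unfolding lattice_ball[OF assms] using assms by (subst card_image) (auto simp: inj_on_def)

text \<open>With \<open>q = \<lfloor>R / \<alpha>\<rfloor>\<close> one has \<open>\<lfloor>4 R / \<alpha>\<rfloor> \<le> 4 q + 3\<close>, and \<open>2 (4 q + 3) + 1 \<le> 7 (2 q + 1)\<close>.\<close>

lemma card_lattice_ball_doubling:
  assumes "0 < \<alpha>" "0 \<le> R"
  shows "card {x \<in> carrier (lattice_group \<alpha>). \<bar>x\<bar> \<le> 4 * R} \<le> 7 * card {x \<in> carrier (lattice_group \<alpha>). \<bar>x\<bar> \<le> R}"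
proof -
  have "R / \<alpha> < of_int \<lfloor>R / \<alpha>\<rfloor> + 1" by linarith
  moreover have "4 * R / \<alpha> = 4 * (R / \<alpha>)" by simp
  ultimately have "4 * R / \<alpha> < of_int (4 * \<lfloor>R / \<alpha>\<rfloor> + 4)" by linarith
  then have "\<lfloor>4 * R / \<alpha>\<rfloor> < 4 * \<lfloor>R / \<alpha>\<rfloor> + 4" by (simp only: floor_less_iff)
  moreover have "0 \<le> \<lfloor>R / \<alpha>\<rfloor>" using assms by simp
  ultimately show ?thesis
    unfolding card_lattice_ball[OF assms(1)] by linarith
qed

lemma comm_group_DirProd:
  assumes "comm_group G" "comm_group H"
  shows "comm_group (G \<times>\<times> H)"
proof (rule group.group_comm_groupI)
  show "group (G \<times>\<times> H)" using assms by (simp add: DirProd_group comm_group_def)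
  fix x y assume "x \<in> carrier (G \<times>\<times> H)" "y \<in> carrier (G \<times>\<times> H)"
  then show "x \<otimes>\<^bsub>G \<times>\<times> H\<^esub> y = y \<otimes>\<^bsub>G \<times>\<times> H\<^esub> x"
    using assms by (auto simp: DirProd_def comm_group_def comm_monoid.m_comm)
qed

lemma index_group_comm_group: "comm_group (index_group d \<alpha> e n)"
  unfolding index_group_def
  by (intro comm_group_DirProd comm_group_product_group lattice_group_comm_group abelian_integer_mod_group)

lemma carrier_index_group:
  "g \<in> carrier (index_group d \<alpha> e n) \<longleftrightarrow> fst g \<in> (\<Pi>\<^sub>E i\<in>{..<d}. carrier (lattice_group (\<alpha> i))) \<and>
     snd g \<in> (\<Pi>\<^sub>E j\<in>{..<e}. carrier (integer_mod_group (n j)))"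
  by (auto simp: index_group_def DirProd_def mem_Times_iff)

lemma mult_index_group:
  "i < d \<Longrightarrow> fst (g \<otimes>\<^bsub>index_group d \<alpha> e n\<^esub> h) i = fst g i + fst h i"
  "j < e \<Longrightarrow> snd (g \<otimes>\<^bsub>index_group d \<alpha> e n\<^esub> h) j = (snd g j + snd h j) mod int (n j)"
  by (auto simp: index_group_def DirProd_def lattice_group_def split: prod.splits)

lemma one_index_group:
  "i < d \<Longrightarrow> fst \<one>\<^bsub>index_group d \<alpha> e n\<^esub> i = 0" "j < e \<Longrightarrow> snd \<one>\<^bsub>index_group d \<alpha> e n\<^esub> j = 0"
  by (auto simp: index_group_def DirProd_def lattice_group_def)

lemma inv_index_group:
  assumes "g \<in> carrier (index_group d \<alpha> e n)"
  shows "i < d \<Longrightarrow> fst (inv\<^bsub>index_group d \<alpha> e n\<^esub> g) i = - fst g i"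
    and "j < e \<Longrightarrow> snd (inv\<^bsub>index_group d \<alpha> e n\<^esub> g) j = (- snd g j) mod int (n j)"
proof -
  let ?P = "product_group {..<d} (\<lambda>i. lattice_group (\<alpha> i))" and ?Q = "product_group {..<e} (\<lambda>j. integer_mod_group (n j))"
  have gr: "group (lattice_group \<beta>)" for \<beta> using lattice_group_comm_group comm_group_def by blast
  have P: "group ?P" "group ?Q" by (auto intro!: product_group gr)
  have g: "fst g \<in> carrier ?P" "snd g \<in> carrier ?Q"
    using assms by (auto simp: carrier_index_group)
  have eq: "inv\<^bsub>index_group d \<alpha> e n\<^esub> g = (inv\<^bsub>?P\<^esub> fst g, inv\<^bsub>?Q\<^esub> snd g)"
    using inv_DirProd[OF P g] by (simp add: index_group_def)
  have "inv\<^bsub>?P\<^esub> fst g = (\<lambda>i\<in>{..<d}. inv\<^bsub>lattice_group (\<alpha> i)\<^esub> fst g i)"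
    using g(1) by (intro inv_product_group) (auto simp: gr)
  moreover have "inv\<^bsub>?Q\<^esub> snd g = (\<lambda>j\<in>{..<e}. inv\<^bsub>integer_mod_group (n j)\<^esub> snd g j)"
    using g(2) by (intro inv_product_group) auto
  moreover have "fst g i \<in> carrier (lattice_group (\<alpha> i))" if "i < d" for i
    using g(1) that by (auto simp: PiE_iff)
  moreover have "snd g j \<in> carrier (integer_mod_group (n j))" if "j < e" for j
    using g(2) that by (auto simp: PiE_iff)
  ultimately show "i < d \<Longrightarrow> fst (inv\<^bsub>index_group d \<alpha> e n\<^esub> g) i = - fst g i"
    and "j < e \<Longrightarrow> snd (inv\<^bsub>index_group d \<alpha> e n\<^esub> g) j = (- snd g j) mod int (n j)"
    by (simp_all add: eq inv_lattice_group)
qed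

lemma index_norm_le_iff:
  assumes "1 \<le> d"
  shows "index_norm d e g \<le> R \<longleftrightarrow> (\<forall>i<d. \<bar>fst g i\<bar> \<le> R) \<and> (\<forall>j<e. torsion_size (snd g j) \<le> R)"
proof -
  let ?X = "(\<lambda>i. \<bar>fst g i\<bar>) ` {..<d} \<union> (\<lambda>j. if snd g j = 0 then 0 else 1) ` {..<e}"
  have "finite ?X" "?X \<noteq> {}" using assms by (auto simp: lessThan_empty_iff)
  then have "Sup ?X \<le> R \<longleftrightarrow> (\<forall>x\<in>?X. x \<le> R)"
    by (intro cSup_le_iff bdd_above_finite)
  then show ?thesis
    unfolding index_norm_def torsion_size_def by (simp only: ball_Un ball_simps lessThan_iff Ball_def image_iff) blast
qed

lemma index_norm_ball:
  assumes "1 \<le> d"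
  shows "{g \<in> carrier (index_group d \<alpha> e n). index_norm d e g \<le> R} =
    (\<Pi>\<^sub>E i\<in>{..<d}. {x \<in> carrier (lattice_group (\<alpha> i)). \<bar>x\<bar> \<le> R}) \<times>
    (\<Pi>\<^sub>E j\<in>{..<e}. {m \<in> carrier (integer_mod_group (n j)). torsion_size m \<le> R})"
  unfolding set_eq_iff mem_Collect_eq index_norm_le_iff[OF assms] carrier_index_group mem_Times_iff PiE_iff Ball_def lessThan_iff
  by blast

text \<open>Balls are products of balls in the factors. The \<open>d\<close> lattice factors contribute \<open>7\<close> each to the
  doubling constant, while the torsion factors of a ball of radius at least \<open>1\<close> are the whole
  cyclic groups.\<close>

lemma index_group_length_group:
  assumes d: "1 \<le> d" and \<alpha>: "\<And>i. i < d \<Longrightarrow> 0 < \<alpha> i" and n: "\<And>j. j < e \<Longrightarrow> 1 \<le> n j"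
  shows "length_group (index_group d \<alpha> e n) (index_norm d e) (7 ^ d)"
proof -
  let ?G = "index_group d \<alpha> e n" and ?N = "index_norm d e"
  note le_iff = index_norm_le_iff[OF d]
  interpret G: comm_group ?G by (rule index_group_comm_group)
  have comp: "\<bar>fst g i\<bar> \<le> ?N g" if "i < d" for g i using le_iff[of e g "?N g"] that by simp
  have tcomp: "torsion_size (snd g j) \<le> ?N g" if "j < e" for g j using le_iff[of e g "?N g"] that by simp
  have nonneg: "0 \<le> ?N g" for g
    using comp[of 0 g] d by (intro order_trans[OF abs_ge_zero]) auto
  have inv_le: "?N (inv\<^bsub>?G\<^esub> g) \<le> ?N g" if g: "g \<in> carrier ?G" for g
    unfolding le_iff
  proof (intro conjI allI impI)
    show "\<bar>fst (inv\<^bsub>?G\<^esub> g) i\<bar> \<le> ?N g" if "i < d" for i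
      using comp[OF that, of g] that by (simp add: inv_index_group[OF g])
    show "torsion_size (snd (inv\<^bsub>?G\<^esub> g) j) \<le> ?N g" if j: "j < e" for j
    proof -
      have "torsion_size (snd (inv\<^bsub>?G\<^esub> g) j) \<le> torsion_size (snd g j)"
        using j by (auto simp: inv_index_group[OF g] torsion_size_def)
      then show ?thesis using tcomp[OF j, of g] by linarith
    qed
  qed
  have fin_lat: "finite {x \<in> carrier (lattice_group (\<alpha> i)). \<bar>x\<bar> \<le> R}" if "i < d" for i R
    unfolding lattice_ball[OF \<alpha>[OF that]] by simp
  have fin_tor: "finite {m \<in> carrier (integer_mod_group (n j)). torsion_size m \<le> R}" if "j < e" for j R
  proof (rule finite_subset)
    show "{m \<in> carrier (integer_mod_group (n j)). torsion_size m \<le> R} \<subseteq> {0..<int (n j)}"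
      using n[OF that] by (auto simp: carrier_integer_mod_group)
  qed simp
  show ?thesis
  proof
    show "0 \<le> ?N g" for g by (rule nonneg)
    show "?N \<one>\<^bsub>?G\<^esub> = 0"
      using nonneg[of "\<one>\<^bsub>?G\<^esub>"] le_iff[of e "\<one>\<^bsub>?G\<^esub>" 0]
      by (auto simp: one_index_group torsion_size_def)
    show "?N (inv\<^bsub>?G\<^esub> g) = ?N g" if "g \<in> carrier ?G" for g
      using inv_le[OF that] inv_le[of "inv\<^bsub>?G\<^esub> g"] that by simp
    show "?N (g \<otimes>\<^bsub>?G\<^esub> h) \<le> ?N g + ?N h" for g h
      unfolding le_iff
    proof (intro conjI allI impI)
      fix i assume "i < d"
      then show "\<bar>fst (g \<otimes>\<^bsub>?G\<^esub> h) i\<bar> \<le> ?N g + ?N h"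
        using comp[of i g] comp[of i h] by (simp add: mult_index_group)
    next
      fix j assume j: "j < e"
      have "torsion_size (snd (g \<otimes>\<^bsub>?G\<^esub> h) j) \<le> torsion_size (snd g j) + torsion_size (snd h j)"
        using j by (auto simp: mult_index_group torsion_size_def)
      then show "torsion_size (snd (g \<otimes>\<^bsub>?G\<^esub> h) j) \<le> ?N g + ?N h"
        using tcomp[OF j, of g] tcomp[OF j, of h] by linarith
    qed
    show "finite {g \<in> carrier ?G. ?N g \<le> R}" for R
      unfolding index_norm_ball[OF d] by (intro finite_cartesian_product finite_PiE) (auto intro: fin_lat fin_tor)
    show "real (card {g \<in> carrier ?G. ?N g \<le> 4 * R}) \<le> 7 ^ d * real (card {g \<in> carrier ?G. ?N g \<le> R})"
      if R: "1 \<le> R" for R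
    proof -
      let ?L = "\<lambda>R i. card {x \<in> carrier (lattice_group (\<alpha> i)). \<bar>x\<bar> \<le> R}"
      let ?T = "\<lambda>R j. card {m \<in> carrier (integer_mod_group (n j)). torsion_size m \<le> R}"
      have card: "card {g \<in> carrier ?G. ?N g \<le> R} = (\<Prod>i<d. ?L R i) * (\<Prod>j<e. ?T R j)" for R
        unfolding index_norm_ball[OF d] by (simp add: card_cartesian_product card_PiE)
      have "(\<Prod>i<d. ?L (4 * R) i) \<le> (\<Prod>i<d. 7 * ?L R i)"
        using R \<alpha> by (intro prod_mono conjI card_lattice_ball_doubling) auto
      also have "\<dots> = 7 ^ d * (\<Prod>i<d. ?L R i)"
        by (simp add: prod.distrib)
      finally have "(\<Prod>i<d. ?L (4 * R) i) * (\<Prod>j<e. ?T (4 * R) j) \<le> 7 ^ d * (\<Prod>i<d. ?L R i) * (\<Prod>j<e. ?T (4 * R) j)"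
        by (rule mult_right_mono) simp
      moreover have "?T (4 * R) j = ?T R j" for j
        using R by (intro arg_cong[where f = card]) (auto simp: torsion_size_def)
      ultimately have "card {g \<in> carrier ?G. ?N g \<le> 4 * R} \<le> 7 ^ d * card {g \<in> carrier ?G. ?N g \<le> R}"
        by (simp add: card mult.assoc)
      then have "real (card {g \<in> carrier ?G. ?N g \<le> 4 * R}) \<le> real (7 ^ d * card {g \<in> carrier ?G. ?N g \<le> R})"
        by (simp only: of_nat_le_iff)
      then show ?thesis by simp
    qed
  qed
qed

section \<open>Bounded fibres and the localization theorem\<close>

text \<open>Finiteness of the limit superior gives one scale \<open>N\<close> at which the relative number of
  indices is bounded uniformly over all boxes. All boxes of this scale have the same size, and the fibre over
  \<open>j\<close> is among the indices counted in the box about \<open>j\<close>.\<close>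

lemma upper_density_finite_fibres:
  assumes lg: "length_group (index_group d \<alpha> e n) (index_norm d e) D"
    and dens: "upper_density d \<alpha> e n I a < \<infinity>"
  obtains \<mu> where "\<And>g. g \<in> carrier (index_group d \<alpha> e n) \<Longrightarrow> finite {i \<in> I. a i = g} \<and> real (card {i \<in> I. a i = g}) \<le> \<mu>"
proof -
  let ?G = "index_group d \<alpha> e n"
  interpret length_group ?G "index_norm d e" D by (rule lg)
  let ?c = "\<lambda>X. emeasure (count_space UNIV) X"
  let ?q = "\<lambda>N j. ?c {i \<in> I. a i \<in> index_box d \<alpha> e n N j} / ?c (index_box d \<alpha> e n N j)"
  let ?X = "\<lambda>N. SUP j\<in>carrier ?G. ?q N j"
  have "\<exists>N. ?X N < \<infinity>"
  proof (rule ccontr)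
    assume "\<nexists>N. ?X N < \<infinity>"
    then have "\<not> ?X N < \<infinity>" for N by blast
    then have "?X N = \<infinity>" for N by (simp only: infinity_ennreal_def less_top[symmetric] not_not)
    then have "upper_density d \<alpha> e n I a = limsup (\<lambda>_. \<infinity>)"
      unfolding upper_density_def by (simp only:)
    then have "upper_density d \<alpha> e n I a = \<infinity>"
      by (simp add: Limsup_const)
    then show False using dens by simp
  qed
  then obtain N where N: "?X N < \<infinity>" by blast
  have box: "index_box d \<alpha> e n N j = {k \<in> carrier ?G. index_norm d e (k \<otimes>\<^bsub>?G\<^esub> inv\<^bsub>?G\<^esub> j) \<le> real N / 2}" for j
    by (simp add: index_box_def index_diff_def)
  define b where "b = card {g \<in> carrier ?G. index_norm d e g \<le> real N / 2}"
  define c where "c = ?X N * of_nat b"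
  have c: "c < \<infinity>" using N by (simp add: c_def ennreal_mult_less_top of_nat_less_top)
  show ?thesis
  proof (rule that)
    fix g assume g: "g \<in> carrier ?G"
    let ?B = "index_box d \<alpha> e n N g" and ?P = "{i \<in> I. a i \<in> index_box d \<alpha> e n N g}"
    have finB: "finite ?B"
      unfolding box by (rule finite_translated_ball[OF bij_gdiff_right[OF g]])
    have gB: "g \<in> ?B" using g by (simp add: box len_one)
    have "inj_on (\<lambda>k. gdiff k g) ?B"
      using bij_betw_imp_inj_on[OF bij_gdiff_right[OF g]] by (rule inj_on_subset) (auto simp: box)
    then have "card ?B \<le> b"
      unfolding b_def by (rule card_inj_on_le[OF _ _ finite_ball]) (use g in \<open>auto simp: box\<close>)
    then have cB: "?c ?B \<le> of_nat b" "?c ?B \<noteq> 0" "?c ?B < \<infinity>"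
      using finB gB by (auto simp: emeasure_count_space_finite of_nat_less_top)
    have "?c ?P = ?q N g * ?c ?B"
      using cB by (simp add: ennreal_divide_times)
    also have "\<dots> \<le> c"
      unfolding c_def using cB g by (intro mult_mono SUP_upper) auto
    finally have P: "?c ?P \<le> c" .
    then have "?c ?P < \<infinity>" using c by (rule order.strict_trans1)
    then have finP: "finite ?P"
      by (cases "finite ?P") (simp_all add: emeasure_count_space_infinite del: mem_Collect_eq)
    then have "ennreal (real (card ?P)) \<le> c"
      using P by (simp add: emeasure_count_space_finite ennreal_of_nat_eq_real_of_nat)
    then have cardP: "real (card ?P) \<le> enn2real c"
      using c enn2real_mono[of "ennreal (real (card ?P))" c] by simp
    have sub: "{i \<in> I. a i = g} \<subseteq> ?P" using gB by auto
    show "finite {i \<in> I. a i = g} \<and> real (card {i \<in> I. a i = g}) \<le> enn2real c"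
      using finite_subset[OF sub finP] card_mono[OF finP sub] cardP by auto
  qed
qed

theorem theorem2p14:
  fixes K :: "complex set"
    and scaleK :: "complex \<Rightarrow> 'h::{real_inner, complete_space} \<Rightarrow> 'h"
    and ip :: "'h \<Rightarrow> 'h \<Rightarrow> complex"
    and I :: "'i set"
    and f :: "'i \<Rightarrow> 'h"
    and d e :: nat
    and \<alpha> :: "nat \<Rightarrow> real"
    and n :: "nat \<Rightarrow> nat"
    and a :: "'i \<Rightarrow> index"
  assumes "hilbert_space K scaleK ip"
    and "separable_space (euclidean :: 'h topology)"
    and "countable I"
    and "d \<ge> 1"
    and "\<And>i. i < d \<Longrightarrow> \<alpha> i > 0"
    and "\<And>j. j < e \<Longrightarrow> n j \<ge> 1"
    and "is_frame ip I f"
    and "a \<in> I \<rightarrow> carrier (index_group d \<alpha> e n)"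
    and "upper_density d \<alpha> e n I a < \<infinity>"
    and "l1_self_localized ip (index_group d \<alpha> e n) I a f"
  shows "l1_localized ip (index_group d \<alpha> e n) I a f (canonical_dual scaleK ip I f) \<and>
         l1_self_localized ip (index_group d \<alpha> e n) I a (canonical_dual scaleK ip I f) \<and>
         l1_self_localized ip (index_group d \<alpha> e n) I a (canonical_parseval K scaleK ip I f)"
proof -
  let ?G = "index_group d \<alpha> e n"
  interpret hilbert_space K scaleK ip by (rule assms(1))
  have lg: "length_group ?G (index_norm d e) (7 ^ d)"
    by (rule index_group_length_group) (use assms(4-6) in auto)
  obtain A B where AB: "0 < A" "0 < B"
    "\<And>x. (\<lambda>i. (cmod (ip x (f i)))\<^sup>2) summable_on I \<and>
       A * (norm x)\<^sup>2 \<le> (\<Sum>\<^sub>\<infinity>i\<in>I. (cmod (ip x (f i)))\<^sup>2) \<and>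
       (\<Sum>\<^sub>\<infinity>i\<in>I. (cmod (ip x (f i)))\<^sup>2) \<le> B * (norm x)\<^sup>2"
    using assms(7) unfolding is_frame_def by blast
  obtain \<mu> where \<mu>: "\<And>g. g \<in> carrier ?G \<Longrightarrow> finite {i \<in> I. a i = g} \<and> real (card {i \<in> I. a i = g}) \<le> \<mu>"
    using upper_density_finite_fibres[OF lg assms(9)] by blast
  obtain r :: "index \<Rightarrow> real" where r: "(\<lambda>k. \<bar>r k\<bar>) summable_on carrier ?G"
    "\<And>i j. i \<in> I \<Longrightarrow> j \<in> I \<Longrightarrow> cmod (ip (f i) (f j)) \<le> r (index_diff ?G (a i) (a j))"
    using assms(10) unfolding l1_self_localized_def l1_localized_def by blast
  interpret length_group ?G "index_norm d e" "7 ^ d" by (rule lg)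
  interpret localized_frame K scaleK ip I f A B ?G "index_norm d e" "7 ^ d" a \<mu> "\<lambda>k. \<bar>r k\<bar>"
  proof unfold_locales
    fix i j assume "i \<in> I" "j \<in> I"
    from r(2)[OF this] show "cmod (ip (f i) (f j)) \<le> \<bar>r (a i \<otimes>\<^bsub>?G\<^esub> inv\<^bsub>?G\<^esub> a j)\<bar>"
      unfolding index_diff_def by linarith
  qed (use AB \<mu> r assms(8) in auto)
  obtain t where t: "t summable_on carrier ?G" "\<And>g. g \<in> carrier ?G \<Longrightarrow> 0 \<le> t g"
    "\<And>k i j. i \<in> I \<Longrightarrow> j \<in> I \<Longrightarrow>
      cmod (ip (inverse_orbit k j) (f i)) \<le> (4 / A) ^ k * t (a i \<otimes>\<^bsub>?G\<^esub> inv\<^bsub>?G\<^esub> a j)"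
    using inverse_powers_localized by blast
  have abs_t: "(\<lambda>g. \<bar>c * t g\<bar>) summable_on carrier ?G" for c
    using summable_on_cmult_right[OF t(1), of "\<bar>c\<bar>"] t(2) by (simp add: abs_mult cong: summable_on_cong)
  define Q where "Q = op_inv S"
  have Q: "positive_op Q" "coercive Q"
    unfolding Q_def by (rule positive_op_inv[OF frame_operator_positive frame_operator_coercive])+
  have Q_sa: "ip (Q x) y = ip x (Q y)" for x y
    using Q(1) by (simp add: positive_operator_def)
  have dual: "canonical_dual scaleK ip I f i = Q (f i)" for i
    by (simp add: canonical_dual_def Q_def)
  have orbit: "inverse_orbit 0 i = Q (f i)" "inverse_orbit 1 i = Q (Q (f i))" for i
    by (simp_all add: inverse_orbit_def Q_def)
  define R where "R = inv_sqrt_operator K scaleK ip S"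
  have R: "positive_op R" "\<And>x. R (R x) = Q x"
    using theI'[OF coercive_square_root[OF Q]] unfolding R_def inv_sqrt_operator_def Q_def by blast+
  have R_sa: "ip (R x) y = ip x (R y)" for x y
    using R(1) by (simp add: positive_operator_def)
  have a_bound: "cmod (ip (f i) (Q (f j))) \<le> 1 * t (index_diff ?G (a i) (a j))" if "i \<in> I" "j \<in> I" for i j
    using t(3)[OF that, of 0] by (simp add: orbit index_diff_def cmod_ip_commute[of "f i"])
  have b_bound: "cmod (ip (Q (f i)) (Q (f j))) \<le> 4 / A * t (index_diff ?G (a i) (a j))" if "i \<in> I" "j \<in> I" for i j
    using t(3)[OF that, of 1] by (simp only: orbit index_diff_def Q_sa cmod_ip_commute[of "f i"] power_one_right)
  have "l1_localized ip ?G I a f (canonical_dual scaleK ip I f)"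
    unfolding l1_localized_def dual using a_bound abs_t[of 1] by (intro exI[of _ "\<lambda>g. 1 * t g"]) blast
  moreover have "l1_self_localized ip ?G I a (canonical_dual scaleK ip I f)"
    unfolding l1_self_localized_def l1_localized_def dual
    using b_bound abs_t[of "4 / A"] by (intro exI[of _ "\<lambda>g. 4 / A * t g"]) blast
  moreover have "l1_self_localized ip ?G I a (canonical_parseval K scaleK ip I f)"
    unfolding l1_self_localized_def l1_localized_def canonical_parseval_def R_def[symmetric] R_sa R(2)
    using a_bound abs_t[of 1] by (intro exI[of _ "\<lambda>g. 1 * t g"]) blast
  ultimately show ?thesis by blast
qed

end
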